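(* Let $\Theta_{\mu,h}$ be a Schrödinger L-system with main operator $T_h$ ($\operatorname{Im} h>0$). Then for any $\mu\in\mathbb R\cup\{\infty\}$ the impedance function $V_{\Theta_{\mu,h}}(z)$ belongs to the Donoghue class $\mathfrak M$ if and only if $h=-m_\infty(i)$.
   Context: Setting. Let $\ell\in\mathbb R$, let $q$ be a real locally summable function on $[\ell,+\infty)$, $l(y)=-y''+q(x)y$, $\mathcal H=L_2(\ell,+\infty)$. Let $D^*$ be the set of $y\in\mathcal H$ that are locally absolutely continuous together with $y'$ and satisfy $l(y)\in\mathcal H$. The minimal symmetric operator $\dot A y=l(y)$ with boundary conditions $y(\ell)=y'(\ell)=0$ is assumed to have deficiency indices $(1,1)$; $\operatorname{Dom}(\dot A^* )=D^*$, $\dot A^*y=l(y)$. For $h\in\mathbb C$ with $\operatorname{Im}h>0$, $T_h y=l(y)$ with domain $\{y\in D^*: y'(\ell)=hy(\ell)\}$. Weyl function. Let $\varphi_1,\varphi_2$ solve $l(\varphi_k)=\lambda\varphi_k$ with $\varphi_1(\ell,\lambda)=0,\varphi_1'(\ell,\lambda)=1$, $\varphi_2(\ell,\lambda)=-1,\varphi_2'(\ell,\lambda)=0$. The Weyl function $m_\infty(\lambda)$ is such that $\varphi_2(\cdot,\lambda)+m_\infty(\lambda)\varphi_1(\cdot,\lambda)\in L_2(\ell,+\infty)$. One has $\operatorname{Im}m_\infty(i)<0$. Schrödinger L-systems. $\mathcal H_+=D^*$ with $(y,z)_+=\int_\ell^\infty (y\bar z+l(y)\overline{l(z)})dx$,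 and $\mathcal H_+\subset\mathcal H\subset\mathcal H_-$ is the corresponding rigged triplet; $\delta(x-\ell),\delta'(x-\ell)\in\mathcal H_-$ act by $(y,\delta)=y(\ell)$, $(y,\delta')=-y'(\ell)$. For $\mu\in\mathbb R\cup\{\infty\}$ put $\mathbb A_{\mu,h}y=-y''+q y-\frac1{\mu-h}[y'(\ell)-hy(\ell)][\mu\delta(x-\ell)+\delta'(x-\ell)]$ and $g=\frac{(\operatorname{Im}h)^{1/2}}{|\mu-h|}[\mu\delta(x-\ell)+\delta'(x-\ell)]$ (limits as $\mu\to\infty$ if $\mu=\infty$), $Kc=cg$ for $c\in\mathbb C$; then $\operatorname{Im}\mathbb A_{\mu,h}=KK^*$. The array $\Theta_{\mu,h}=(\mathbb A_{\mu,h},K,1;\ \mathcal H_+\subset\mathcal H\subset\mathcal H_-,\mathbb C)$ is the Schrödinger L-system with main operator $T_h$ and state-space operator $\mathbb A_{\mu,h}$. Its impedance function is $V_{\Theta_{\mu,h}}(z)=K^*(\operatorname{Re}\mathbb A_{\mu,h}-zI)^{-1}K=\frac{(m_\infty(z)+\mu)\operatorname{Im}h}{(\mu-\operatorname{Re}h)m_\infty(z)+\mu\operatorname{Re}h-|h|^2}$ (for $\mu=\infty$: $\frac{\operatorname{Im}h}{m_\infty(z)+\operatorname{Re}h}$). Donoghue class. $\mathfrak M$ is the class of all analytic maps $M$ of $\mathbb C_+$ into itself with $M(z)=\int_{\mathbb R}\left(\frac1{\lambda-z}-\frac{\lambda}{1+\lambda^2}\right)d\sigma(\lambda)$, $\sigma$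 an infinite Borel measure with $\int_{\mathbb R}\frac{d\sigma(\lambda)}{1+\lambda^2}=1$ (equivalently, $M(i)=i$). *)

theory Defs
  imports "HOL-Analysis.Analysis"
begin

text \<open>
  Functions on the half-line \<open>[l, \<infinity>)\<close> are total functions \<open>real \<Rightarrow> complex\<close> of which only the values on
  \<open>{l..}\<close> are ever used. Elements of \<open>L\<^sub>2(l, \<infinity>)\<close> are represented by square integrable functions,
  so that equality in \<open>L\<^sub>2(l, \<infinity>)\<close> is equality almost everywhere.
\<close>

subsection \<open>Locally absolutely continuous functions and the differential expression\<close>

definition abs_cont_on :: "real \<Rightarrow> real \<Rightarrow> (real \<Rightarrow> complex) \<Rightarrow> bool" where
  "abs_cont_on a b f \<longleftrightarrow>
     (\<forall>\<epsilon>>0. \<exists>\<delta>>0. \<forall>\<D>. \<D> division_of \<Union>\<D> \<and> \<Union>\<D> \<subseteq> {a..b} \<and> (\<Sum>I\<in>\<D>. Sup I - Inf I) < \<delta> \<longrightarrow>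
        (\<Sum>I\<in>\<D>. cmod (f (Sup I) - f (Inf I))) < \<epsilon>)"

definition loc_abs_cont :: "real \<Rightarrow> (real \<Rightarrow> complex) \<Rightarrow> bool" where
  "loc_abs_cont l f \<longleftrightarrow> (\<forall>b. abs_cont_on l b f)"

definition loc_summable :: "real \<Rightarrow> (real \<Rightarrow> real) \<Rightarrow> bool" where
  "loc_summable l q \<longleftrightarrow> (\<forall>b. q absolutely_integrable_on {l..b})"

text \<open>The derivative on \<open>[l, \<infinity>)\<close>; it is the right-hand one at the end-point \<open>l\<close>.\<close>

definition D1 :: "real \<Rightarrow> (real \<Rightarrow> complex) \<Rightarrow> real \<Rightarrow> complex" where
  "D1 l y x = vector_derivative y (at x within {l..})"

text \<open>
  The functions that are locally absolutely continuous together with their derivative. The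
  almost everywhere differentiability of \<open>y'\<close> follows from its local absolute continuity
  (Lebesgue); it is recorded because \<^const>\<open>vector_derivative\<close> is a total function and the
  second derivative is only meaningful where it exists.
\<close>

definition AC2 :: "real \<Rightarrow> (real \<Rightarrow> complex) set" where
  "AC2 l = {y. loc_abs_cont l y \<and>
               (\<forall>x\<ge>l. y differentiable (at x within {l..})) \<and>
               loc_abs_cont l (D1 l y) \<and>
               (AE x in lebesgue_on {l..}. D1 l y differentiable (at x within {l..}))}"

definition schr_expr :: "real \<Rightarrow> (real \<Rightarrow> real) \<Rightarrow> (real \<Rightarrow> complex) \<Rightarrow> real \<Rightarrow> complex" where
  "schr_expr l q y x = - D1 l (D1 l y) x + complex_of_real (q x) * y x"


subsection \<open>The space \<open>L\<^sub>2(l, \<infinity>)\<close> and the operators generated by the expression\<close>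

definition L2 :: "real \<Rightarrow> (real \<Rightarrow> complex) set" where
  "L2 l = {f. f \<in> borel_measurable (lebesgue_on {l..}) \<and>
              integrable (lebesgue_on {l..}) (\<lambda>x. (cmod (f x))\<^sup>2)}"

definition ip :: "real \<Rightarrow> (real \<Rightarrow> complex) \<Rightarrow> (real \<Rightarrow> complex) \<Rightarrow> complex" where
  "ip l f g = (LINT x|lebesgue_on {l..}. f x * cnj (g x))"

definition D_star :: "real \<Rightarrow> (real \<Rightarrow> real) \<Rightarrow> (real \<Rightarrow> complex) set" where
  "D_star l q = {y \<in> AC2 l. y \<in> L2 l \<and> schr_expr l q y \<in> L2 l}"

definition dom_min :: "real \<Rightarrow> (real \<Rightarrow> real) \<Rightarrow> (real \<Rightarrow> complex) set" where
  "dom_min l q = {y \<in> D_star l q. y l = 0 \<and> D1 l y l = 0}"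

definition min_symmetric :: "real \<Rightarrow> (real \<Rightarrow> real) \<Rightarrow> bool" where
  "min_symmetric l q \<longleftrightarrow>
     (\<forall>u\<in>dom_min l q. \<forall>v\<in>dom_min l q. ip l (schr_expr l q u) v = ip l u (schr_expr l q v))"

text \<open>The graph of the Hilbert space adjoint of the minimal operator.\<close>

definition min_adjoint :: "real \<Rightarrow> (real \<Rightarrow> real) \<Rightarrow> ((real \<Rightarrow> complex) \<times> (real \<Rightarrow> complex)) set" where
  "min_adjoint l q = {(y, f). y \<in> L2 l \<and> f \<in> L2 l \<and>
                        (\<forall>u\<in>dom_min l q. ip l (schr_expr l q u) y = ip l u f)}"

definition deficiency_space :: "real \<Rightarrow> (real \<Rightarrow> real) \<Rightarrow> complex \<Rightarrow> (real \<Rightarrow> complex) set" where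
  "deficiency_space l q z = {y. (y, \<lambda>x. z * y x) \<in> min_adjoint l q}"

text \<open>One-dimensionality of a subspace of \<open>L\<^sub>2(l, \<infinity>)\<close>, i.e. modulo equality almost everywhere.\<close>

definition one_dim :: "real \<Rightarrow> (real \<Rightarrow> complex) set \<Rightarrow> bool" where
  "one_dim l N \<longleftrightarrow>
     (\<exists>e\<in>N. \<not> (AE x in lebesgue_on {l..}. e x = 0) \<and>
            (\<forall>y\<in>N. \<exists>c. AE x in lebesgue_on {l..}. y x = c * e x))"

definition deficiency_indices_1_1 :: "real \<Rightarrow> (real \<Rightarrow> real) \<Rightarrow> bool" where
  "deficiency_indices_1_1 l q \<longleftrightarrow>
     one_dim l (deficiency_space l q \<i>) \<and> one_dim l (deficiency_space l q (- \<i>))"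

definition dom_T :: "real \<Rightarrow> (real \<Rightarrow> real) \<Rightarrow> complex \<Rightarrow> (real \<Rightarrow> complex) set" where
  "dom_T l q h = {y \<in> D_star l q. D1 l y l = h * y l}"


subsection \<open>The Weyl function\<close>

definition solves :: "real \<Rightarrow> (real \<Rightarrow> real) \<Rightarrow> complex \<Rightarrow> (real \<Rightarrow> complex) \<Rightarrow> bool" where
  "solves l q z \<phi> \<longleftrightarrow>
     \<phi> \<in> AC2 l \<and> (AE x in lebesgue_on {l..}. schr_expr l q \<phi> x = z * \<phi> x)"

definition weyl_function :: "real \<Rightarrow> (real \<Rightarrow> real) \<Rightarrow> (complex \<Rightarrow> complex) \<Rightarrow> bool" where
  "weyl_function l q m \<longleftrightarrow>
     (\<forall>z. Im z \<noteq> 0 \<longrightarrow>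
       (\<exists>\<phi>1 \<phi>2. solves l q z \<phi>1 \<and> \<phi>1 l = 0 \<and> D1 l \<phi>1 l = 1 \<and>
                solves l q z \<phi>2 \<and> \<phi>2 l = - 1 \<and> D1 l \<phi>2 l = 0 \<and>
                (\<lambda>x. \<phi>2 x + m z * \<phi>1 x) \<in> L2 l))"


subsection \<open>L-systems with input-output space \<open>\<complex>\<close>\<close>

text \<open>
  An element \<open>F\<close> of \<open>H\<^sub>-\<close> is represented by the antilinear functional \<open>w \<mapsto> (F, w)\<close> on \<open>H\<^sub>+\<close>, where
  \<open>(F, w)\<close> extends the inner product of \<open>H\<close>; it is the complex conjugate of \<open>(w, F)\<close>. Two such
  functionals denote the same element if they agree on \<open>H\<^sub>+\<close>. In these terms \<open>f \<in> H\<close>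
  is the functional \<open>w \<mapsto> (f, w)\<close>.
\<close>

record 'a lsystem =
  hplus :: "'a set"
  embed :: "'a \<Rightarrow> 'a \<Rightarrow> complex"
  state_op :: "'a \<Rightarrow> 'a \<Rightarrow> complex"
  channel_op :: "complex \<Rightarrow> 'a \<Rightarrow> complex"
  direction_op :: "complex \<Rightarrow> complex"

text \<open>The adjoint \<open>A*: H\<^sub>+ \<rightarrow> H\<^sub>-\<close> of \<open>A: H\<^sub>+ \<rightarrow> H\<^sub>-\<close> is given by \<open>(A* y, w) = (y, A w)\<close>.\<close>

definition state_adj :: "'a lsystem \<Rightarrow> 'a \<Rightarrow> 'a \<Rightarrow> complex" where
  "state_adj \<Theta> y w = cnj (state_op \<Theta> w y)"

definition state_re :: "'a lsystem \<Rightarrow> 'a \<Rightarrow> 'a \<Rightarrow> complex" where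
  "state_re \<Theta> y w = (state_op \<Theta> y w + state_adj \<Theta> y w) / 2"

text \<open>\<open>K*: H\<^sub>+ \<rightarrow> \<complex>\<close> is determined by \<open>(K* y) \<cdot> cnj c = (y, K c)\<close>; take \<open>c = 1\<close>.\<close>

definition channel_adj :: "'a lsystem \<Rightarrow> 'a \<Rightarrow> complex" where
  "channel_adj \<Theta> y = cnj (channel_op \<Theta> 1 y)"

definition re_resolvent :: "'a lsystem \<Rightarrow> complex \<Rightarrow> ('a \<Rightarrow> complex) \<Rightarrow> 'a" where
  "re_resolvent \<Theta> z F =
     (SOME y. y \<in> hplus \<Theta> \<and> (\<forall>w\<in>hplus \<Theta>. state_re \<Theta> y w - z * embed \<Theta> y w = F w))"

text \<open>The operator \<open>K* (Re A - z I)\<^sup>-\<^sup>1 K\<close> on \<open>\<complex>\<close>, identified with its value at \<open>1\<close>.\<close>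

definition impedance :: "'a lsystem \<Rightarrow> complex \<Rightarrow> complex" where
  "impedance \<Theta> z = channel_adj \<Theta> (re_resolvent \<Theta> z (channel_op \<Theta> 1))"


subsection \<open>Schroedinger L-systems\<close>

datatype xreal = Fin real | Infty

definition delta :: "real \<Rightarrow> (real \<Rightarrow> complex) \<Rightarrow> complex" where
  "delta l w = cnj (w l)"

definition delta' :: "real \<Rightarrow> (real \<Rightarrow> complex) \<Rightarrow> complex" where
  "delta' l w = - cnj (D1 l w l)"

fun state_A ::
  "real \<Rightarrow> (real \<Rightarrow> real) \<Rightarrow> xreal \<Rightarrow> complex \<Rightarrow> (real \<Rightarrow> complex) \<Rightarrow> (real \<Rightarrow> complex) \<Rightarrow> complex" where
  "state_A l q (Fin \<mu>) h y w =
     ip l (schr_expr l q y) w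
       - 1 / (of_real \<mu> - h) * (D1 l y l - h * y l) * (of_real \<mu> * delta l w + delta' l w)"
| "state_A l q Infty h y w =
     ip l (schr_expr l q y) w - (D1 l y l - h * y l) * delta l w"

fun channel_g :: "real \<Rightarrow> xreal \<Rightarrow> complex \<Rightarrow> (real \<Rightarrow> complex) \<Rightarrow> complex" where
  "channel_g l (Fin \<mu>) h w =
     of_real (sqrt (Im h) / cmod (of_real \<mu> - h)) * (of_real \<mu> * delta l w + delta' l w)"
| "channel_g l Infty h w = of_real (sqrt (Im h)) * delta l w"

definition schr_lsystem ::
  "real \<Rightarrow> (real \<Rightarrow> real) \<Rightarrow> xreal \<Rightarrow> complex \<Rightarrow> (real \<Rightarrow> complex) lsystem" where
  "schr_lsystem l q \<mu> h =
     \<lparr>hplus = D_star l q, embed = ip l, state_op = state_A l q \<mu> h,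
      channel_op = (\<lambda>c w. c * channel_g l \<mu> h w), direction_op = id\<rparr>"

text \<open>The values at \<open>Infty\<close> are the limits as \<open>\<mu> \<rightarrow> \<infinity>\<close>, and the main operator \<open>T\<^sub>h\<close> is contained in
  the state-space operator.\<close>

lemma tendsto_inverse_diff_at_top:
  "((\<lambda>\<mu>. inverse (complex_of_real \<mu> - h)) \<longlongrightarrow> 0) at_top"
proof -
  have "filterlim (\<lambda>\<mu>. - h + complex_of_real \<mu>) at_infinity at_top"
    by (rule tendsto_add_filterlim_at_infinity[OF tendsto_const filterlim_of_real_at_infinity])
  then have "((\<lambda>\<mu>. inverse (- h + complex_of_real \<mu>)) \<longlongrightarrow> 0) at_top"
    by (rule filterlim_compose[OF tendsto_inverse_0])
  then show ?thesis
    by simp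
qed

lemma tendsto_divide_diff_at_top:
  "((\<lambda>\<mu>. complex_of_real \<mu> * inverse (complex_of_real \<mu> - h)) \<longlongrightarrow> 1) at_top"
proof -
  have "((\<lambda>\<mu>. 1 + h * inverse (complex_of_real \<mu> - h)) \<longlongrightarrow> 1 + h * 0) at_top"
    by (intro tendsto_intros tendsto_inverse_diff_at_top)
  then have lim: "((\<lambda>\<mu>. 1 + h * inverse (complex_of_real \<mu> - h)) \<longlongrightarrow> 1) at_top"
    by simp
  have "eventually (\<lambda>\<mu>. 1 + h * inverse (complex_of_real \<mu> - h) =
          complex_of_real \<mu> * inverse (complex_of_real \<mu> - h)) at_top"
    using eventually_gt_at_top[of "Re h"]
  proof eventually_elim
    case (elim \<mu>)
    then have "complex_of_real \<mu> - h \<noteq> 0"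
      by (auto simp: complex_eq_iff)
    then show ?case
      by (simp add: field_simps)
  qed
  with lim show ?thesis
    by (rule Lim_transform_eventually)
qed

lemma state_A_Infty_limit:
  "((\<lambda>\<mu>. state_A l q (Fin \<mu>) h y w) \<longlongrightarrow> state_A l q Infty h y w) at_top"
proof -
  let ?B = "D1 l y l - h * y l"
  have "((\<lambda>\<mu>. ip l (schr_expr l q y) w
           - ?B * ((complex_of_real \<mu> * inverse (complex_of_real \<mu> - h)) * delta l w
                   + inverse (complex_of_real \<mu> - h) * delta' l w))
         \<longlongrightarrow> ip l (schr_expr l q y) w - ?B * (1 * delta l w + 0 * delta' l w)) at_top"
    by (intro tendsto_intros tendsto_inverse_diff_at_top tendsto_divide_diff_at_top)
  then show ?thesis
    by (simp add: divide_inverse algebra_simps)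
qed

lemma channel_g_Infty_limit:
  "((\<lambda>\<mu>. channel_g l (Fin \<mu>) h w) \<longlongrightarrow> channel_g l Infty h w) at_top"
proof -
  let ?s = "complex_of_real (sqrt (Im h))"
  let ?r = "\<lambda>\<mu>. complex_of_real (cmod (inverse (complex_of_real \<mu> - h)))"
  have r: "(?r \<longlongrightarrow> complex_of_real (cmod 0)) at_top"
    by (intro tendsto_intros tendsto_inverse_diff_at_top)
  have "((\<lambda>\<mu>. complex_of_real (cmod (complex_of_real \<mu> * inverse (complex_of_real \<mu> - h))))
          \<longlongrightarrow> complex_of_real (cmod 1)) at_top"
    by (intro tendsto_intros tendsto_divide_diff_at_top)
  moreover have "eventually (\<lambda>\<mu>. complex_of_real (cmod (complex_of_real \<mu> * inverse (complex_of_real \<mu> - h)))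
                    = complex_of_real \<mu> * ?r \<mu>) at_top"
    using eventually_ge_at_top[of 0] by eventually_elim (simp add: norm_mult)
  ultimately have \<mu>r: "((\<lambda>\<mu>. complex_of_real \<mu> * ?r \<mu>) \<longlongrightarrow> complex_of_real (cmod 1)) at_top"
    by (rule Lim_transform_eventually)
  have "((\<lambda>\<mu>. ?s * ((complex_of_real \<mu> * ?r \<mu>) * delta l w + ?r \<mu> * delta' l w))
          \<longlongrightarrow> ?s * (complex_of_real (cmod 1) * delta l w + complex_of_real (cmod 0) * delta' l w)) at_top"
    by (intro tendsto_intros r \<mu>r)
  then show ?thesis
    by (simp add: divide_inverse norm_inverse algebra_simps)
qed

lemma state_A_main_operator:
  assumes "y \<in> dom_T l q h"
  shows "state_A l q \<mu> h y w = ip l (schr_expr l q y) w"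
  using assms by (cases \<mu>) (simp_all add: dom_T_def)


subsection \<open>The Donoghue class\<close>

definition donoghue_class :: "(complex \<Rightarrow> complex) set" where
  "donoghue_class =
     {M. M analytic_on {z. Im z > 0} \<and> (\<forall>z. Im z > 0 \<longrightarrow> Im (M z) > 0) \<and>
         (\<exists>\<sigma> :: real measure. sets \<sigma> = sets borel \<and> emeasure \<sigma> UNIV = \<infinity> \<and>
            (\<integral>\<^sup>+ t. ennreal (1 / (1 + t\<^sup>2)) \<partial>\<sigma>) = 1 \<and>
            (\<forall>z. Im z > 0 \<longrightarrow>
               M z = (LINT t|\<sigma>. 1 / (of_real t - z) - of_real (t / (1 + t\<^sup>2)))))}"

end

theory Submission
  imports Defs
    "HOL-Probability.Helly_Selection"
    "HOL-Complex_Analysis.Cauchy_Integral_Formula"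
    "HOL-Real_Asymp.Real_Asymp"
begin

text \<open>
  Let \<open>L\<close> be the differential expression and \<open>[y, w] = y'(l) cnj (w(l)) - y(l) cnj (w'(l))\<close>. A solution
  of \<open>L y = i y\<close>, cut off by a smooth function, is an element of \<open>D*\<close> with arbitrary values \<open>y(l)\<close>,
  \<open>y'(l)\<close>, support in \<open>[l, l + e]\<close> and arbitrarily small norm. Subtracting such elements moves any
  two members of \<open>D*\<close> into the domain of the minimal operator without changing them near infinity,
  so symmetry of the minimal operator says that no boundary term survives at infinity:
  \<open>(L y, w) - (y, L w) = [y, w]\<close> on all of \<open>D*\<close> (\<open>green_formula\<close>).

  It follows that \<open>Re A\<close> is the form \<open>(L y, w)\<close> minus \<open>Q y\<close> times a multiple of the channel
  functional of \<open>w\<close>, where \<open>Q y\<close> depends on the boundary values of \<open>y\<close> (\<open>state_re_eq\<close>). Hence a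
  multiple of the Weyl solution \<open>\<phi>2 + m(z) \<phi>1\<close> solves \<open>(Re A - z) y = K 1\<close>, and the impedance is a
  Moebius transform of \<open>m(z)\<close> (\<open>impedance_formula\<close>). Solving \<open>V(i) = i\<close> in this formula gives
  exactly \<open>h = - m(i)\<close> (\<open>impedance_at_i_iff\<close>). As the kernel \<open>1/(t - i) - t/(1 + t\<^sup>2)\<close> is
  \<open>i/(1 + t\<^sup>2)\<close>, members of the Donoghue class take the value \<open>i\<close> at \<open>i\<close>; this is one implication.

  For the other one, \<open>V(i) = i\<close> has to produce the integral representation. The vectors
  \<open>y(z) = (Re A - z)\<^sup>-\<^sup>1 K 1\<close> solve a Hermitian resolvent equation, and the resolvent identity
  \<open>V(z) - V(u) = (z - u) (y(z), y(cnj u))\<close> makes \<open>V\<close> holomorphic with \<open>Im V(z) = Im z ||y(z)||\<^sup>2\<close>.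
  The cut-off elements show that the domain of the self-adjoint restriction of \<open>Re A\<close> is dense, so
  that \<open>Im V(iT)/T \<rightarrow> 0\<close>, and that the channel functional is not bounded in the norm of
  \<open>L\<^sub>2\<close>, so that \<open>T Im V(iT)\<close> is unbounded. Herglotz' theorem on the disc, proved from the Schwarz
  integral formula and Helly's selection theorem, gives a representing probability measure on the
  circle. Carried to the line, the first growth condition excludes a linear term, and the second one
  makes the measure infinite (\<open>donoghue_classI\<close>).
\<close>

section \<open>Absolutely continuous functions\<close>

lemma sum_content_division_le_measure:
  fixes \<D> :: "real set set"
  assumes D: "\<D> division_of \<Union>\<D>" and sub: "\<Union>\<D> \<subseteq> U" and U: "U \<in> lmeasurable"
  shows "(\<Sum>I\<in>\<D>. Sup I - Inf I) \<le> measure lebesgue U"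
proof -
  have meas: "K \<in> lmeasurable" if "K \<in> \<D>" for K
    using division_ofD(4)[OF D that] by auto
  have "pairwise (\<lambda>S T. negligible (S \<inter> T)) \<D>"
  proof (clarsimp simp: pairwise_def)
    fix S T assume ST: "S \<in> \<D>" "T \<in> \<D>" "S \<noteq> T"
    obtain a b where S: "S = cbox a b" using division_ofD(4)[OF D ST(1)] by blast
    obtain c d where T: "T = cbox c d" using division_ofD(4)[OF D ST(2)] by blast
    have "interior S \<inter> interior T = {}" using division_ofD(5)[OF D] ST by blast
    then have "interior (S \<inter> T) = {}" by simp
    moreover have "convex (S \<inter> T)" unfolding S T by (intro convex_Int convex_box)
    ultimately show "negligible (S \<inter> T)"
      using negligible_convex_interior by blast
  qed
  then have "measure lebesgue (\<Union>\<D>) = sum (measure lebesgue) \<D>"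
    by (intro measure_negligible_finite_Union meas division_ofD(1)[OF D])
  moreover have "sum (measure lebesgue) \<D> = (\<Sum>I\<in>\<D>. Sup I - Inf I)"
  proof (rule sum.cong[OF refl])
    fix I assume "I \<in> \<D>"
    then obtain a b where "I = cbox a b" "I \<noteq> {}" using division_ofD(3,4)[OF D] by metis
    then show "measure lebesgue I = Sup I - Inf I" by auto
  qed
  moreover have "measure lebesgue (\<Union>\<D>) \<le> measure lebesgue U"
    using meas division_ofD(1)[OF D]
    by (intro measure_mono_fmeasurable[OF sub _ U]) (auto intro!: fmeasurableD sets.finite_Union)
  ultimately show ?thesis by simp
qed

lemma abs_cont_onE:
  assumes "abs_cont_on a b F" "e > 0"
  obtains \<delta> where "\<delta> > 0"
    "\<And>\<D>. \<D> division_of \<Union>\<D> \<Longrightarrow> \<Union>\<D> \<subseteq> {a..b} \<Longrightarrow> (\<Sum>I\<in>\<D>. Sup I - Inf I) < \<delta> \<Longrightarrow>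
        (\<Sum>I\<in>\<D>. cmod (F (Sup I) - F (Inf I))) < e"
proof -
  have "\<exists>\<delta>>0. \<forall>\<D>. \<D> division_of \<Union>\<D> \<and> \<Union>\<D> \<subseteq> {a..b} \<and> (\<Sum>I\<in>\<D>. Sup I - Inf I) < \<delta> \<longrightarrow>
        (\<Sum>I\<in>\<D>. cmod (F (Sup I) - F (Inf I))) < e"
    using assms unfolding abs_cont_on_def by (elim allE[of _ e]) simp
  then show ?thesis using that by (elim exE conjE) simp
qed

text \<open>
  The derivative of an absolutely continuous function is integrated by a direct Henstock-Kurzweil
  argument, so that integrability is part of the conclusion. Off \<open>N\<close> the gauge comes from
  differentiability, as in the classical theorem; at tags in \<open>N\<close> it keeps the intervals inside an
  open set of small measure, where absolute continuity bounds the total increment of \<open>F\<close>.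
\<close>

theorem abs_cont_fundamental_theorem:
  assumes F: "abs_cont_on a b F" and "a \<le> b" and N: "negligible N"
    and deriv: "\<And>x. x \<in> {a..b} - N \<Longrightarrow> (F has_vector_derivative g x) (at x within {a..b})"
  shows "(g has_integral (F b - F a)) {a..b}"
proof (rule has_integral_spike[OF N])
  define g' where "g' = (\<lambda>x. if x \<in> N then 0 else g x)"
  show "g x = g' x" if "x \<in> {a..b} - N" for x
    using that by (simp add: g'_def)
  show "(g' has_integral (F b - F a)) {a..b}"
    unfolding has_integral_real
  proof (intro allI impI)
    fix e :: real assume "e > 0"
    then have "e / 2 > 0" by simp
    from abs_cont_onE[OF F this] obtain \<delta> where "\<delta> > 0" and \<delta>:
      "\<And>\<D>. \<D> division_of \<Union>\<D> \<Longrightarrow> \<Union>\<D> \<subseteq> {a..b} \<Longrightarrow> (\<Sum>I\<in>\<D>. Sup I - Inf I) < \<delta> \<Longrightarrow>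
        (\<Sum>I\<in>\<D>. cmod (F (Sup I) - F (Inf I))) < e / 2"
      by blast
    have Nn: "N \<in> null_sets lebesgue" using N negligible_iff_null_sets by blast
    then obtain U where U: "open U" "N \<subseteq> U" "U - N \<in> lmeasurable" "emeasure lebesgue (U - N) < ennreal \<delta>"
      using sets_lebesgue_outer_open[of N \<delta>] \<open>\<delta> > 0\<close> by blast
    have UN: "U = (U - N) \<union> N" using U(2) by blast
    have Um: "U \<in> lmeasurable"
      using fmeasurable.Un[OF U(3) negligible_imp_measurable[OF N]] UN by simp
    have "measure lebesgue U = measure lebesgue (U - N)"
      using measure_Un_null_set[OF fmeasurableD[OF U(3)] Nn] UN by simp
    then have U\<delta>: "measure lebesgue U < \<delta>"
      using U(3,4) \<open>\<delta> > 0\<close> by (simp add: emeasure_eq_measure2 ennreal_less_iff)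
    define \<eta> where "\<eta> = e / (2 * (b - a + 1))"
    have "\<eta> > 0" using \<open>e > 0\<close> \<open>a \<le> b\<close> by (simp add: \<eta>_def)
    have "\<exists>d>0. (x \<in> N \<longrightarrow> ball x d \<subseteq> U) \<and> (x \<in> {a..b} - N \<longrightarrow>
         (\<forall>y\<in>{a..b}. norm (y-x) < d \<longrightarrow> norm (F y - F x - (y-x) *\<^sub>R g x) \<le> \<eta> * norm (y-x)))" for x
    proof (cases "x \<in> N")
      case True
      then show ?thesis using U(1,2) open_contains_ball by blast
    next
      case False
      then show ?thesis
        using deriv[of x] \<open>\<eta> > 0\<close>
        unfolding has_vector_derivative_def has_derivative_within_alt
        by (cases "x \<in> {a..b}") (auto intro: exI[of _ 1])
    qed
    then obtain d where d0: "\<And>x. 0 < d x" and dN: "\<And>x. x \<in> N \<Longrightarrow> ball x (d x) \<subseteq> U"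
      and d: "\<And>x y. \<lbrakk>x \<in> {a..b}; x \<notin> N; y \<in> {a..b}; norm (y-x) < d x\<rbrakk>
                        \<Longrightarrow> norm (F y - F x - (y-x) *\<^sub>R g x) \<le> \<eta> * norm (y-x)"
      by (metis DiffI)
    show "\<exists>\<gamma>. gauge \<gamma> \<and> (\<forall>p. p tagged_division_of {a..b} \<and> \<gamma> fine p \<longrightarrow>
            norm ((\<Sum>(x, k)\<in>p. measure lborel k *\<^sub>R g' x) - (F b - F a)) < e)"
    proof (intro exI conjI allI impI)
      show "gauge (\<lambda>x. ball x (d x))"
        using d0 gauge_ball_dependent by blast
      fix p assume "p tagged_division_of {a..b} \<and> (\<lambda>x. ball x (d x)) fine p"
      then have ptag: "p tagged_division_of {a..b}" and fine: "(\<lambda>x. ball x (d x)) fine p" by auto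
      let ?E = "\<lambda>(x, K). measure lborel K *\<^sub>R g' x - (F (Sup K) - F (Inf K))"
      define pN where "pN = {t \<in> p. fst t \<in> N}"
      have fin: "finite p" using ptag by blast
      have split: "(\<Sum>(x, k)\<in>p. measure lborel k *\<^sub>R g' x) - (F b - F a) = sum ?E pN + sum ?E (p - pN)"
      proof -
        have "(\<Sum>(x, k)\<in>p. measure lborel k *\<^sub>R g' x) - (F b - F a) = sum ?E p"
          by (simp add: additive_tagged_division_1[OF \<open>a \<le> b\<close> ptag, symmetric] split_def
               sum_subtractf[symmetric])
        also have "\<dots> = sum ?E (p - pN) + sum ?E pN"
          by (rule sum.subset_diff) (auto simp: pN_def fin)
        finally show ?thesis by simp
      qed
      have interval: "\<exists>u v. K = {u..v} \<and> u \<le> v \<and> u \<le> x \<and> x \<le> v \<and> {u..v} \<subseteq> {a..b} \<and> {u..v} \<subseteq> ball x (d x)"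
        if xK: "(x, K) \<in> p" for x K
      proof -
        obtain u v where "K = cbox u v" using tagged_division_ofD(4)[OF ptag xK] by blast
        moreover have "x \<in> K" "K \<subseteq> {a..b}" using tagged_division_ofD(2,3)[OF ptag xK] by blast+
        moreover have "K \<subseteq> ball x (d x)" using fine xK by (auto simp: fine_def)
        ultimately show ?thesis by auto
      qed
      \<comment> \<open>Off the exceptional set the increments are controlled by differentiability.\<close>
      have reg: "norm (?E (x, K)) \<le> \<eta> * (Sup K - Inf K)" if xK: "(x, K) \<in> p - pN" for x K
      proof -
        obtain u v where K: "K = {u..v}" "u \<le> v" "u \<le> x" "x \<le> v" "{u..v} \<subseteq> {a..b}" "{u..v} \<subseteq> ball x (d x)"
          using interval xK by blast
        have x: "x \<in> {a..b}" "x \<notin> N" using K xK by (auto simp: pN_def)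
        have *: "norm (F y - F x - (y-x) *\<^sub>R g x) \<le> \<eta> * norm (y-x)" if "y \<in> {u..v}" for y
          using that K by (intro d[OF x]) (auto simp: dist_real_def subset_iff)
        have "norm (?E (x, K)) = norm ((F u - F x - (u - x) *\<^sub>R g x) - (F v - F x - (v - x) *\<^sub>R g x))"
          using K x by (simp add: g'_def algebra_simps)
        also have "\<dots> \<le> norm (F u - F x - (u - x) *\<^sub>R g x) + norm (F v - F x - (v - x) *\<^sub>R g x)"
          by (rule norm_triangle_ineq4)
        also have "\<dots> \<le> \<eta> * norm (u - x) + \<eta> * norm (v - x)"
          using K by (intro add_mono *) auto
        also have "\<dots> = \<eta> * (Sup K - Inf K)"
          using K by (simp add: algebra_simps)
        finally show ?thesis .
      qed
      have "norm (sum ?E (p - pN)) \<le> (\<Sum>t\<in>p - pN. \<eta> * (Sup (snd t) - Inf (snd t)))"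
        using reg by (intro sum_norm_le) auto
      also have "\<dots> \<le> (\<Sum>t\<in>p. \<eta> * (Sup (snd t) - Inf (snd t)))"
      proof (rule sum_mono2[OF fin])
        fix t assume "t \<in> p - (p - pN)"
        then obtain u v where "snd t = {u..v}" "u \<le> v" using interval[of "fst t" "snd t"] by auto
        then show "0 \<le> \<eta> * (Sup (snd t) - Inf (snd t))" using \<open>\<eta> > 0\<close> by simp
      qed auto
      also have "\<dots> = \<eta> * (b - a)"
        using additive_tagged_division_1[OF \<open>a \<le> b\<close> ptag, of "\<lambda>x. x"]
        by (simp add: sum_distrib_left[symmetric] split_def)
      also have "\<dots> \<le> e / 2"
        using \<open>a \<le> b\<close> \<open>e > 0\<close> by (simp add: \<eta>_def field_simps)
      finally have 1: "norm (sum ?E (p - pN)) \<le> e / 2" .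
      \<comment> \<open>The intervals tagged in the exceptional set form a division of a set of small measure.\<close>
      have part: "pN tagged_partial_division_of {a..b}"
      proof (rule tagged_partial_division_subset)
        show "p tagged_partial_division_of {a..b}" using ptag unfolding tagged_division_of_def by blast
      qed (auto simp: pN_def)
      then have div: "snd ` pN division_of \<Union>(snd ` pN)"
        by (rule partial_division_of_tagged_division)
      have inj: "inj_on snd pN"
      proof (rule inj_onI)
        fix s t assume st: "s \<in> pN" "t \<in> pN" "snd s = snd t"
        obtain x y K where s: "s = (x, K)" and t: "t = (y, K)" using st by (cases s; cases t) auto
        obtain u v where K: "K = {u..v}" "u \<le> x" "x \<le> v" using interval[of x K] st s by (auto simp: pN_def)
        have y: "y \<in> {u..v}" using interval[of y K] st t K by (auto simp: pN_def)
        show "s = t"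
        proof (rule ccontr)
          assume "s \<noteq> t"
          then have "interior K \<inter> interior K = {}"
            using tagged_partial_division_ofD(5)[OF part, of x K y K] st s t by auto
          then have "u \<ge> v" using K by (simp add: interior_atLeastAtMost_real)
          then show False using K y \<open>s \<noteq> t\<close> s t by auto
        qed
      qed
      have "norm (sum ?E pN) \<le> (\<Sum>t\<in>pN. cmod (F (Sup (snd t)) - F (Inf (snd t))))"
        by (intro sum_norm_le) (auto simp: pN_def g'_def norm_minus_commute)
      also have "\<dots> = (\<Sum>I\<in>snd ` pN. cmod (F (Sup I) - F (Inf I)))"
        by (simp add: sum.reindex[OF inj])
      also have "\<dots> < e / 2"
      proof (rule \<delta>[OF div])
        show "\<Union>(snd ` pN) \<subseteq> {a..b}" using tagged_partial_division_ofD(3)[OF part] by fastforce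
        have "\<Union>(snd ` pN) \<subseteq> U"
        proof clarsimp
          fix y x K assume "(x, K) \<in> pN" "y \<in> K"
          then show "y \<in> U" using interval[of x K] dN[of x] by (auto simp: pN_def)
        qed
        then show "(\<Sum>I\<in>snd ` pN. Sup I - Inf I) < \<delta>"
          using sum_content_division_le_measure[OF div _ Um] U\<delta> by fastforce
      qed
      finally have 2: "norm (sum ?E pN) < e / 2" .
      show "norm ((\<Sum>(x, k)\<in>p. measure lborel k *\<^sub>R g' x) - (F b - F a)) < e"
        unfolding split using norm_triangle_ineq[of "sum ?E pN" "sum ?E (p - pN)"] 1 2 by linarith
    qed
  qed
qed
lemma abs_cont_on_identity: "abs_cont_on a b of_real"
  unfolding abs_cont_on_def
proof (intro allI impI)
  fix e :: real assume "e > 0"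
  show "\<exists>\<delta>>0. \<forall>\<D>. \<D> division_of \<Union> \<D> \<and> \<Union> \<D> \<subseteq> {a..b} \<and> (\<Sum>I\<in>\<D>. Sup I - Inf I) < \<delta> \<longrightarrow>
     (\<Sum>I\<in>\<D>. cmod (of_real (Sup I) - of_real (Inf I))) < e"
  proof (intro exI[of _ e] conjI allI impI \<open>e > 0\<close>; elim conjE)
    fix \<D> :: "real set set"
    assume D: "\<D> division_of \<Union> \<D>" and less: "(\<Sum>I\<in>\<D>. Sup I - Inf I) < e"
    have "(\<Sum>I\<in>\<D>. cmod (of_real (Sup I) - of_real (Inf I))) = (\<Sum>I\<in>\<D>. Sup I - Inf I)"
    proof (rule sum.cong[OF refl])
      fix I assume "I \<in> \<D>"
      then obtain a b where "I = cbox a b" "I \<noteq> {}" using division_ofD(3,4)[OF D] by metis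
      then show "cmod (of_real (Sup I) - of_real (Inf I)) = Sup I - Inf I"
        by (auto simp flip: of_real_diff)
    qed
    with less show "(\<Sum>I\<in>\<D>. cmod (of_real (Sup I) - of_real (Inf I))) < e" by simp
  qed
qed

text \<open>
  A common source of the closure properties below: increments controlled by those of two
  absolutely continuous functions.
\<close>

lemma abs_cont_on_dominated:
  assumes f: "abs_cont_on a b f" and g: "abs_cont_on a b g"
    and dom: "\<And>x y. x \<in> {a..b} \<Longrightarrow> y \<in> {a..b} \<Longrightarrow> cmod (k x - k y) \<le> M * (cmod (f x - f y) + cmod (g x - g y))"
  shows "abs_cont_on a b k"
  unfolding abs_cont_on_def
proof (intro allI impI)
  fix e :: real assume "e > 0"
  define e' where "e' = e / (2 * (\<bar>M\<bar> + 1))"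
  have "e' > 0" using \<open>e > 0\<close> by (simp add: e'_def add_nonneg_pos)
  obtain d1 where d1: "d1 > 0" "\<And>\<D>. \<D> division_of \<Union>\<D> \<Longrightarrow> \<Union>\<D> \<subseteq> {a..b} \<Longrightarrow> (\<Sum>I\<in>\<D>. Sup I - Inf I) < d1 \<Longrightarrow>
        (\<Sum>I\<in>\<D>. cmod (f (Sup I) - f (Inf I))) < e'"
    by (rule abs_cont_onE[OF f \<open>e' > 0\<close>]) blast
  obtain d2 where d2: "d2 > 0" "\<And>\<D>. \<D> division_of \<Union>\<D> \<Longrightarrow> \<Union>\<D> \<subseteq> {a..b} \<Longrightarrow> (\<Sum>I\<in>\<D>. Sup I - Inf I) < d2 \<Longrightarrow>
        (\<Sum>I\<in>\<D>. cmod (g (Sup I) - g (Inf I))) < e'"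
    by (rule abs_cont_onE[OF g \<open>e' > 0\<close>]) blast
  show "\<exists>\<delta>>0. \<forall>\<D>. \<D> division_of \<Union> \<D> \<and> \<Union> \<D> \<subseteq> {a..b} \<and> (\<Sum>I\<in>\<D>. Sup I - Inf I) < \<delta> \<longrightarrow>
     (\<Sum>I\<in>\<D>. cmod (k (Sup I) - k (Inf I))) < e"
  proof (intro exI[of _ "min d1 d2"] conjI allI impI; (elim conjE)?)
    show "min d1 d2 > 0" using d1 d2 by simp
    fix \<D> :: "real set set"
    assume D: "\<D> division_of \<Union> \<D>" "\<Union> \<D> \<subseteq> {a..b}" and less: "(\<Sum>I\<in>\<D>. Sup I - Inf I) < min d1 d2"
    let ?s = "\<lambda>f. \<Sum>I\<in>\<D>. cmod (f (Sup I) - f (Inf I))"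
    have "?s k \<le> (\<Sum>I\<in>\<D>. M * (cmod (f (Sup I) - f (Inf I)) + cmod (g (Sup I) - g (Inf I))))"
    proof (intro sum_mono dom)
      fix I assume I: "I \<in> \<D>"
      then obtain u v where "I = cbox u v" "I \<noteq> {}" using division_ofD(3,4)[OF D(1)] by metis
      moreover have "I \<subseteq> {a..b}" using D(2) I by blast
      ultimately show "Sup I \<in> {a..b}" "Inf I \<in> {a..b}" by auto
    qed
    also have "\<dots> = M * (?s f + ?s g)"
      by (simp only: sum_distrib_left[symmetric] sum.distrib)
    also have "\<dots> \<le> \<bar>M\<bar> * (?s f + ?s g)"
      by (intro mult_right_mono add_nonneg_nonneg sum_nonneg) auto
    also have "\<dots> \<le> \<bar>M\<bar> * (e' + e')"
      using d1(2)[OF D] d2(2)[OF D] less by (intro mult_left_mono add_mono) auto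
    also have "\<dots> < (\<bar>M\<bar> + 1) * (e' + e')"
      using \<open>e' > 0\<close> by (intro mult_strict_right_mono) auto
    also have "\<dots> = e" using abs_ge_zero[of M] by (simp add: e'_def divide_simps)
    finally show "?s k < e" .
  qed
qed

lemma abs_cont_on_lipschitz:
  assumes "\<And>x y. x \<in> {a..b} \<Longrightarrow> y \<in> {a..b} \<Longrightarrow> cmod (k x - k y) \<le> M * \<bar>x - y\<bar>"
  shows "abs_cont_on a b k"
proof (rule abs_cont_on_dominated[OF abs_cont_on_identity abs_cont_on_identity, of _ _ _ "M/2"])
  fix x y assume "x \<in> {a..b}" "y \<in> {a..b}"
  then show "cmod (k x - k y) \<le> M / 2 * (cmod (of_real x - of_real y) + cmod (of_real x - of_real y))"
    using assms[of x y] by (simp flip: of_real_diff)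
qed

lemma abs_cont_on_imp_continuous_on:
  assumes f: "abs_cont_on a b f"
  shows "continuous_on {a..b} f"
  unfolding continuous_on_iff
proof (intro ballI allI impI)
  fix x e assume x: "x \<in> {a..b}" and "(e::real) > 0"
  obtain d where d: "d > 0" "\<And>\<D>. \<D> division_of \<Union>\<D> \<Longrightarrow> \<Union>\<D> \<subseteq> {a..b} \<Longrightarrow> (\<Sum>I\<in>\<D>. Sup I - Inf I) < d \<Longrightarrow>
        (\<Sum>I\<in>\<D>. cmod (f (Sup I) - f (Inf I))) < e"
    by (rule abs_cont_onE[OF f \<open>e > 0\<close>]) blast
  have *: "cmod (f v - f u) < e" if "u \<le> v" "v - u < d" "u \<in> {a..b}" "v \<in> {a..b}" for u v
  proof -
    have "{{u..v}} division_of \<Union>{{u..v}}"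
      using division_of_self[of u v] that by (simp add: cbox_interval)
    from d(2)[OF this] show ?thesis using that by auto
  qed
  show "\<exists>d>0. \<forall>x'\<in>{a..b}. dist x' x < d \<longrightarrow> dist (f x') (f x) < e"
  proof (intro exI[of _ d] conjI d(1) ballI impI)
    fix y assume "y \<in> {a..b}" "dist y x < d"
    then show "dist (f y) (f x) < e"
      using *[of x y] *[of y x] x
      by (cases "x \<le> y") (auto simp: dist_norm norm_minus_commute)
  qed
qed

lemma abs_cont_on_lincomb:
  assumes "abs_cont_on a b f" "abs_cont_on a b g"
  shows "abs_cont_on a b (\<lambda>x. c * f x + d * g x)"
proof (rule abs_cont_on_dominated[OF assms, of _ "cmod c + cmod d"])
  fix x y
  have "cmod (c * f x + d * g x - (c * f y + d * g y)) \<le> cmod c * cmod (f x - f y) + cmod d * cmod (g x - g y)"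
  proof -
    have "c * f x + d * g x - (c * f y + d * g y) = c * (f x - f y) + d * (g x - g y)"
      by (simp add: algebra_simps)
    then show ?thesis
      using norm_triangle_ineq[of "c * (f x - f y)" "d * (g x - g y)"] by (simp only: norm_mult)
  qed
  then show "cmod (c * f x + d * g x - (c * f y + d * g y)) \<le> (cmod c + cmod d) * (cmod (f x - f y) + cmod (g x - g y))"
    using mult_nonneg_nonneg[OF norm_ge_zero norm_ge_zero, of d "f x - f y"]
      mult_nonneg_nonneg[OF norm_ge_zero norm_ge_zero, of c "g x - g y"]
    unfolding distrib_left distrib_right by linarith
qed

lemma abs_cont_on_mult:
  assumes f: "abs_cont_on a b f" and g: "abs_cont_on a b g"
  shows "abs_cont_on a b (\<lambda>x. f x * g x)"
proof -
  have bnd: "\<exists>B. \<forall>x\<in>{a..b}. cmod (k x) \<le> B" if "abs_cont_on a b k" for k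
    using compact_imp_bounded[OF compact_continuous_image[OF abs_cont_on_imp_continuous_on[OF that] compact_Icc]]
    by (auto simp: bounded_iff)
  obtain A where A: "\<And>x. x \<in> {a..b} \<Longrightarrow> cmod (f x) \<le> A" using bnd[OF f] by blast
  obtain B where B: "\<And>x. x \<in> {a..b} \<Longrightarrow> cmod (g x) \<le> B" using bnd[OF g] by blast
  show ?thesis
  proof (rule abs_cont_on_dominated[OF f g, of _ "max A B"])
    fix x y assume xy: "x \<in> {a..b}" "y \<in> {a..b}"
    have "cmod (f x * g x - f y * g y) \<le> cmod (f x) * cmod (g x - g y) + cmod (g y) * cmod (f x - f y)"
    proof -
      have "f x * g x - f y * g y = f x * (g x - g y) + g y * (f x - f y)"
        by (simp add: algebra_simps)
      then show ?thesis
        using norm_triangle_ineq[of "f x * (g x - g y)" "g y * (f x - f y)"] by (simp only: norm_mult)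
    qed
    also have "\<dots> \<le> max A B * cmod (g x - g y) + max A B * cmod (f x - f y)"
      using A[OF xy(1)] B[OF xy(2)] by (intro add_mono mult_right_mono) auto
    finally show "cmod (f x * g x - f y * g y) \<le> max A B * (cmod (f x - f y) + cmod (g x - g y))"
      by (simp add: algebra_simps)
  qed
qed

lemma abs_cont_on_cnj:
  assumes "abs_cont_on a b f"
  shows "abs_cont_on a b (\<lambda>x. cnj (f x))"
  by (rule abs_cont_on_dominated[OF assms assms, of _ 1]) (simp flip: complex_cnj_diff)

lemma abs_cont_on_C1:
  assumes "\<And>x. x \<in> {a..b} \<Longrightarrow> (f has_vector_derivative f' x) (at x within {a..b})"
    and "continuous_on {a..b} f'"
  shows "abs_cont_on a b f"
proof -
  obtain B where B: "\<And>x. x \<in> {a..b} \<Longrightarrow> cmod (f' x) \<le> B"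
    using compact_imp_bounded[OF compact_continuous_image[OF assms(2) compact_Icc]]
    by (auto simp: bounded_iff simp del: atLeastAtMost_iff)
  show ?thesis
  proof (rule abs_cont_on_lipschitz)
    fix x y assume xy: "x \<in> {a..b}" "y \<in> {a..b}"
    have "cmod (f x - f y) \<le> B * norm (x - y)"
    proof (rule differentiable_bound[of "{a..b}" f "\<lambda>x h. h *\<^sub>R f' x"])
      fix u assume u: "u \<in> {a..b}"
      show "(f has_derivative (\<lambda>h. h *\<^sub>R f' u)) (at u within {a..b})"
        using assms(1)[OF u] by (simp add: has_vector_derivative_def)
      show "onorm (\<lambda>h. h *\<^sub>R f' u) \<le> B"
        by (rule onorm_le) (use B[OF u] in \<open>simp add: mult.commute[of B] mult_left_mono\<close>)
    qed (use xy in auto)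
    then show "cmod (f x - f y) \<le> B * \<bar>x - y\<bar>" by simp
  qed
qed

section \<open>The function spaces of the differential expression\<close>

lemma at_within_atLeast_nontrivial:
  fixes l x :: real
  assumes "l \<le> x" shows "at x within {l..} \<noteq> bot"
proof -
  have "at_right x \<le> at x within {l..}" using assms by (intro at_le) auto
  then show ?thesis using trivial_limit_at_right_real[of x] by (auto simp: bot_unique)
qed

lemma D1_eqI:
  assumes "l \<le> x" "(y has_vector_derivative v) (at x within {l..})"
  shows "D1 l y x = v"
  unfolding D1_def using assms by (intro vector_derivative_within at_within_atLeast_nontrivial)

lemma AC2_has_derivative:
  assumes "y \<in> AC2 l" "l \<le> x"
  shows "(y has_vector_derivative D1 l y x) (at x within {l..})"
  using assms unfolding AC2_def D1_def by (simp add: vector_derivative_works[symmetric])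

lemma AC2_has_second_derivative:
  assumes "y \<in> AC2 l"
  shows "AE x in lebesgue_on {l..}. (D1 l y has_vector_derivative D1 l (D1 l y) x) (at x within {l..})"
proof -
  have "AE x in lebesgue_on {l..}. D1 l y differentiable (at x within {l..})"
    using assms by (simp add: AC2_def)
  then show ?thesis
    by eventually_elim (metis D1_def vector_derivative_works)
qed

lemma AC2_loc_abs_cont:
  assumes "y \<in> AC2 l"
  shows "abs_cont_on l b y" "abs_cont_on l b (D1 l y)"
  using assms by (auto simp: AC2_def loc_abs_cont_def)

lemma AC2_continuous_on:
  assumes "y \<in> AC2 l"
  shows "continuous_on {l..} y" "continuous_on {l..} (D1 l y)"
proof -
  have *: "continuous_on {l..} f" if f: "\<And>b. abs_cont_on l b f" for f
    unfolding continuous_on_eq_continuous_within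
  proof
    fix x assume x: "x \<in> {l..}"
    have "at x within {l..} = at x within {l..x+1}"
      by (rule at_within_nhd[of x "{..<x+1}"]) auto
    moreover have "continuous (at x within {l..x+1}) f"
      using abs_cont_on_imp_continuous_on[OF f[of "x+1"]] x
      unfolding continuous_on_eq_continuous_within by auto
    ultimately show "continuous (at x within {l..}) f" by simp
  qed
  show "continuous_on {l..} y" "continuous_on {l..} (D1 l y)"
    using AC2_loc_abs_cont[OF assms] by (auto intro: *)
qed

text \<open>
  Membership in \<open>AC2\<close> is checked on candidates \<open>y'\<close> and \<open>y''\<close> for the derivatives. Absolute continuity
  of \<open>y\<close> is automatic since \<open>y\<close> has the continuous derivative \<open>y'\<close>.
\<close>

lemma AC2_I:
  assumes y: "\<And>x. l \<le> x \<Longrightarrow> (y has_vector_derivative y' x) (at x within {l..})"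
    and y': "\<And>b. abs_cont_on l b y'"
    and y'': "AE x in lebesgue_on {l..}. (y' has_vector_derivative y'' x) (at x within {l..})"
  shows "y \<in> AC2 l" "\<And>x. l \<le> x \<Longrightarrow> D1 l y x = y' x"
    "AE x in lebesgue_on {l..}. D1 l (D1 l y) x = y'' x"
proof -
  show D1: "D1 l y x = y' x" if "l \<le> x" for x
    using D1_eqI[OF that y[OF that]] .
  have ge: "AE x in lebesgue_on {l..}. l \<le> x"
    by (rule AE_I2) simp
  have D2: "AE x in lebesgue_on {l..}. (D1 l y has_vector_derivative y'' x) (at x within {l..})"
    using y'' ge
  proof eventually_elim
    case (elim x)
    then show ?case
      using has_vector_derivative_transform[of x "{l..}" "D1 l y" y' "y'' x"] by (simp add: D1)
  qed
  show "AE x in lebesgue_on {l..}. D1 l (D1 l y) x = y'' x"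
    using D2 ge by eventually_elim (rule D1_eqI)
  show "y \<in> AC2 l"
    unfolding AC2_def
  proof (intro CollectI conjI allI impI)
    show "loc_abs_cont l y"
      unfolding loc_abs_cont_def
    proof
      fix b show "abs_cont_on l b y"
        using abs_cont_on_imp_continuous_on[OF y'[of b]]
        by (intro abs_cont_on_C1[of _ _ _ y'] has_vector_derivative_within_subset[OF y]) auto
    qed
    show "loc_abs_cont l (D1 l y)"
      unfolding loc_abs_cont_def
      by (intro allI abs_cont_on_dominated[OF y' y', of _ _ 1]) (auto simp: D1)
    show "y differentiable (at x within {l..})" if "l \<le> x" for x
      using y[OF that] by (auto simp: has_vector_derivative_def differentiable_def)
    show "AE x in lebesgue_on {l..}. D1 l y differentiable (at x within {l..})"
      using D2 by eventually_elim (auto simp: has_vector_derivative_def differentiable_def)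
  qed
qed

lemma AC2_lincomb:
  assumes u: "u \<in> AC2 l" and v: "v \<in> AC2 l"
  shows "(\<lambda>x. a * u x + b * v x) \<in> AC2 l"
    "\<And>x. l \<le> x \<Longrightarrow> D1 l (\<lambda>x. a * u x + b * v x) x = a * D1 l u x + b * D1 l v x"
    "AE x in lebesgue_on {l..}. schr_expr l q (\<lambda>x. a * u x + b * v x) x = a * schr_expr l q u x + b * schr_expr l q v x"
proof -
  have 1: "((\<lambda>x. a * u x + b * v x) has_vector_derivative a * D1 l u x + b * D1 l v x) (at x within {l..})"
    if "l \<le> x" for x
    by (intro has_vector_derivative_add has_vector_derivative_mult_right AC2_has_derivative u v that)
  have 2: "abs_cont_on l c (\<lambda>x. a * D1 l u x + b * D1 l v x)" for c
    by (intro abs_cont_on_lincomb AC2_loc_abs_cont u v)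
  have 3: "AE x in lebesgue_on {l..}. ((\<lambda>x. a * D1 l u x + b * D1 l v x) has_vector_derivative
      a * D1 l (D1 l u) x + b * D1 l (D1 l v) x) (at x within {l..})"
    using AC2_has_second_derivative[OF u] AC2_has_second_derivative[OF v]
    by eventually_elim (intro has_vector_derivative_add has_vector_derivative_mult_right)
  show "(\<lambda>x. a * u x + b * v x) \<in> AC2 l"
    by (rule AC2_I(1)[OF _ 2 3]) (rule 1)
  show "D1 l (\<lambda>x. a * u x + b * v x) x = a * D1 l u x + b * D1 l v x" if "l \<le> x" for x
    by (rule AC2_I(2)[OF _ 2 3 that]) (rule 1)
  have "AE x in lebesgue_on {l..}. D1 l (D1 l (\<lambda>x. a * u x + b * v x)) x = a * D1 l (D1 l u) x + b * D1 l (D1 l v) x"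
    by (rule AC2_I(3)[OF _ 2 3]) (rule 1)
  then show "AE x in lebesgue_on {l..}. schr_expr l q (\<lambda>x. a * u x + b * v x) x = a * schr_expr l q u x + b * schr_expr l q v x"
    by eventually_elim (simp add: schr_expr_def algebra_simps)
qed

lemma borel_measurable_cnj_compose [measurable (raw)]:
  "f \<in> borel_measurable M \<Longrightarrow> (\<lambda>x. cnj (f x)) \<in> borel_measurable M"
  by (rule measurable_compose[OF _ borel_measurable_continuous_onI[OF continuous_on_cnj[OF continuous_on_id]]])

lemma L2_D:
  assumes "f \<in> L2 l"
  shows "f \<in> borel_measurable (lebesgue_on {l..})" "integrable (lebesgue_on {l..}) (\<lambda>x. (cmod (f x))\<^sup>2)"
  using assms by (auto simp: L2_def)

lemma L2_lincomb:
  assumes f: "f \<in> L2 l" and g: "g \<in> L2 l"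
  shows "(\<lambda>x. a * f x + b * g x) \<in> L2 l"
proof -
  note [measurable] = L2_D(1)[OF f] L2_D(1)[OF g]
  have "integrable (lebesgue_on {l..}) (\<lambda>x. (cmod (a * f x + b * g x))\<^sup>2)"
  proof (rule Bochner_Integration.integrable_bound)
    show "integrable (lebesgue_on {l..}) (\<lambda>x. 2 * (cmod a)\<^sup>2 * (cmod (f x))\<^sup>2 + 2 * (cmod b)\<^sup>2 * (cmod (g x))\<^sup>2)"
      using L2_D(2)[OF f] L2_D(2)[OF g] by auto
    show "AE x in lebesgue_on {l..}. norm ((cmod (a * f x + b * g x))\<^sup>2) \<le>
        norm (2 * (cmod a)\<^sup>2 * (cmod (f x))\<^sup>2 + 2 * (cmod b)\<^sup>2 * (cmod (g x))\<^sup>2)"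
    proof (rule AE_I2)
      fix x
      have "(cmod (a * f x + b * g x))\<^sup>2 \<le> (cmod a * cmod (f x) + cmod b * cmod (g x))\<^sup>2"
        using norm_triangle_ineq[of "a * f x" "b * g x"] by (intro power_mono) (auto simp: norm_mult)
      also have "\<dots> \<le> 2 * (cmod a)\<^sup>2 * (cmod (f x))\<^sup>2 + 2 * (cmod b)\<^sup>2 * (cmod (g x))\<^sup>2"
        using sum_squares_bound[of "cmod a * cmod (f x)" "cmod b * cmod (g x)"]
        by (simp add: power2_sum power_mult_distrib)
      finally show "norm ((cmod (a * f x + b * g x))\<^sup>2) \<le>
        norm (2 * (cmod a)\<^sup>2 * (cmod (f x))\<^sup>2 + 2 * (cmod b)\<^sup>2 * (cmod (g x))\<^sup>2)"
        by simp
    qed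
  qed measurable
  then show ?thesis by (simp add: L2_def)
qed

lemma borel_measurable_lebesgue_on_AE:
  fixes f g :: "real \<Rightarrow> complex"
  assumes "f \<in> borel_measurable (lebesgue_on {l..})" "AE x in lebesgue_on {l..}. f x = g x"
  shows "g \<in> borel_measurable (lebesgue_on {l..})"
proof -
  have "(\<lambda>x. if x \<in> {l..} then g x else 0) \<in> borel_measurable lebesgue"
  proof (rule borel_measurable_AE)
    show "(\<lambda>x. if x \<in> {l..} then f x else 0) \<in> borel_measurable lebesgue"
      using assms(1) by (subst borel_measurable_if) auto
    have "AE x in lebesgue. x \<in> {l..} \<longrightarrow> f x = g x"
      using assms(2) by (simp add: AE_restrict_space_iff)
    then show "AE x in lebesgue. (if x \<in> {l..} then f x else 0) = (if x \<in> {l..} then g x else 0)"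
      by eventually_elim auto
  qed
  then show ?thesis by (subst (asm) borel_measurable_if) auto
qed

lemma L2_cong_AE:
  assumes f: "f \<in> L2 l" and fg: "AE x in lebesgue_on {l..}. f x = g x"
  shows "g \<in> L2 l"
proof -
  note g = borel_measurable_lebesgue_on_AE[OF L2_D(1)[OF f] fg]
  then have [measurable]: "g \<in> borel_measurable (lebesgue_on {l..})" .
  have "integrable (lebesgue_on {l..}) (\<lambda>x. (cmod (g x))\<^sup>2)"
    by (rule integrable_cong_AE_imp[OF L2_D(2)[OF f]]) (use fg in auto)
  with g show ?thesis by (simp add: L2_def)
qed

lemma L2_integrable_mult_cnj:
  assumes f: "f \<in> L2 l" and g: "g \<in> L2 l"
  shows "integrable (lebesgue_on {l..}) (\<lambda>x. f x * cnj (g x))"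
proof (rule Bochner_Integration.integrable_bound)
  note [measurable] = L2_D(1)[OF f] L2_D(1)[OF g]
  show "integrable (lebesgue_on {l..}) (\<lambda>x. (cmod (f x))\<^sup>2 + (cmod (g x))\<^sup>2)"
    using L2_D(2)[OF f] L2_D(2)[OF g] by auto
  show "(\<lambda>x. f x * cnj (g x)) \<in> borel_measurable (lebesgue_on {l..})" by measurable
  show "AE x in lebesgue_on {l..}. norm (f x * cnj (g x)) \<le> norm ((cmod (f x))\<^sup>2 + (cmod (g x))\<^sup>2)"
  proof (rule AE_I2)
    fix x show "norm (f x * cnj (g x)) \<le> norm ((cmod (f x))\<^sup>2 + (cmod (g x))\<^sup>2)"
      using sum_squares_bound[of "cmod (f x)" "cmod (g x)"] 
        mult_nonneg_nonneg[OF norm_ge_zero norm_ge_zero, of "f x" "g x"]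
      unfolding norm_mult complex_mod_cnj real_norm_def by linarith
  qed
qed

lemma ip_cong_AE:
  assumes "f \<in> L2 l" "g \<in> L2 l" "AE x in lebesgue_on {l..}. f x = f' x" "AE x in lebesgue_on {l..}. g x = g' x"
  shows "ip l f g = ip l f' g'"
  unfolding ip_def
proof (rule integral_cong_AE)
  have m: "f' \<in> borel_measurable (lebesgue_on {l..})" "g' \<in> borel_measurable (lebesgue_on {l..})"
    using L2_cong_AE assms L2_D(1) by blast+
  show "(\<lambda>x. f x * cnj (g x)) \<in> borel_measurable (lebesgue_on {l..})"
    using L2_D(1)[OF assms(1)] L2_D(1)[OF assms(2)] by simp
  show "(\<lambda>x. f' x * cnj (g' x)) \<in> borel_measurable (lebesgue_on {l..})"
    using m by simp
  show "AE x in lebesgue_on {l..}. f x * cnj (g x) = f' x * cnj (g' x)"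
    using assms(3,4) by eventually_elim simp
qed

lemma ip_lincomb_left:
  assumes "u \<in> L2 l" "v \<in> L2 l" "w \<in> L2 l"
  shows "ip l (\<lambda>x. a * u x + b * v x) w = a * ip l u w + b * ip l v w"
proof -
  have "ip l (\<lambda>x. a * u x + b * v x) w = (LINT x|lebesgue_on {l..}. a * (u x * cnj (w x)) + b * (v x * cnj (w x)))"
    unfolding ip_def by (intro Bochner_Integration.integral_cong) (auto simp: algebra_simps)
  also have "\<dots> = a * ip l u w + b * ip l v w"
    unfolding ip_def using assms
    by (subst Bochner_Integration.integral_add) (auto intro: L2_integrable_mult_cnj)
  finally show ?thesis .
qed

lemma ip_hermitian: "ip l v u = cnj (ip l u v)"
proof -
  have "(LINT x|lebesgue_on {l..}. cnj (u x * cnj (v x))) = cnj (ip l u v)"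
    unfolding ip_def by (rule Bochner_Integration.integral_cnj)
  then show ?thesis by (simp add: ip_def mult.commute)
qed

lemma ip_self: "ip l f f = of_real (LINT x|lebesgue_on {l..}. (cmod (f x))\<^sup>2)"
  unfolding ip_def by (simp add: complex_norm_square[symmetric] flip: of_real_power)

lemma D_star_D:
  assumes "y \<in> D_star l q"
  shows "y \<in> AC2 l" "y \<in> L2 l" "schr_expr l q y \<in> L2 l"
  using assms by (auto simp: D_star_def)

lemma D_star_lincomb:
  assumes u: "u \<in> D_star l q" and v: "v \<in> D_star l q"
  shows "(\<lambda>x. a * u x + b * v x) \<in> D_star l q"
    and "w \<in> L2 l \<Longrightarrow> ip l (schr_expr l q (\<lambda>x. a * u x + b * v x)) w =
      a * ip l (schr_expr l q u) w + b * ip l (schr_expr l q v) w"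
proof -
  note u = D_star_D[OF u] and v = D_star_D[OF v]
  have ae: "AE x in lebesgue_on {l..}. a * schr_expr l q u x + b * schr_expr l q v x = schr_expr l q (\<lambda>x. a * u x + b * v x) x"
    using AC2_lincomb(3)[OF u(1) v(1), of q a b] by eventually_elim simp
  note L2 = L2_lincomb[OF u(3) v(3), of a b]
  show "(\<lambda>x. a * u x + b * v x) \<in> D_star l q"
    unfolding D_star_def
    using AC2_lincomb(1)[OF u(1) v(1)] L2_lincomb[OF u(2) v(2)] L2_cong_AE[OF L2 ae] by simp
  assume w: "w \<in> L2 l"
  have "ip l (schr_expr l q (\<lambda>x. a * u x + b * v x)) w = ip l (\<lambda>x. a * schr_expr l q u x + b * schr_expr l q v x) w"
    by (rule ip_cong_AE[symmetric, OF L2 w ae]) simp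
  then show "ip l (schr_expr l q (\<lambda>x. a * u x + b * v x)) w =
      a * ip l (schr_expr l q u) w + b * ip l (schr_expr l q v) w"
    by (simp add: ip_lincomb_left[OF u(3) v(3) w])
qed

section \<open>Green's formula\<close>

text \<open>
  The sesquilinear Wronskian, which vanishes at infinity exactly when Green's formula has no
  boundary term there.
\<close>

definition wronskian :: "real \<Rightarrow> (real \<Rightarrow> complex) \<Rightarrow> (real \<Rightarrow> complex) \<Rightarrow> real \<Rightarrow> complex" where
  "wronskian l y w x = y x * cnj (D1 l w x) - D1 l y x * cnj (w x)"

text \<open>
  The derivative of the Wronskian is \<open>L y cnj w - y cnj (L w)\<close>, with \<open>L\<close> the differential
  expression; the real potential cancels in it. This function is integrable over the half-line, so the Wronskian has a limit.
\<close>

lemma lagrange_identity: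
  assumes y: "y \<in> D_star l q" and w: "w \<in> D_star l q"
  shows "(wronskian l y w \<longlongrightarrow>
    wronskian l y w l + ip l (schr_expr l q y) w - ip l y (schr_expr l q w)) at_top"
proof -
  note y = D_star_D[OF y] and w = D_star_D[OF w]
  let ?G = "\<lambda>x. schr_expr l q y x * cnj (w x) - y x * cnj (schr_expr l q w x)"
  have deriv: "AE x in lebesgue_on {l..}. (wronskian l y w has_vector_derivative ?G x) (at x within {l..})"
    using AC2_has_second_derivative[OF y(1)] AC2_has_second_derivative[OF w(1)] AE_space[of "lebesgue_on {l..}"]
  proof eventually_elim
    case (elim x)
    then have x: "l \<le> x" by simp
    have "(wronskian l y w has_vector_derivative
        (y x * cnj (D1 l (D1 l w) x) + D1 l y x * cnj (D1 l w x)) -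
        (D1 l y x * cnj (D1 l w x) + D1 l (D1 l y) x * cnj (w x))) (at x within {l..})"
      unfolding wronskian_def
      by (intro has_vector_derivative_diff has_vector_derivative_mult has_vector_derivative_cnj
            AC2_has_derivative y w x elim)
    then show ?case by (simp add: schr_expr_def algebra_simps)
  qed
  then have "AE x in lebesgue. x \<in> {l..} \<longrightarrow> (wronskian l y w has_vector_derivative ?G x) (at x within {l..})"
    by (simp add: AE_restrict_space_iff)
  then obtain N where N: "N \<in> null_sets lebesgue"
    "{x. \<not> (x \<in> {l..} \<longrightarrow> (wronskian l y w has_vector_derivative ?G x) (at x within {l..}))} \<subseteq> N"
    unfolding eventually_ae_filter by auto
  have AC: "abs_cont_on l b (wronskian l y w)" for b
  proof -
    have "abs_cont_on l b (\<lambda>x. 1 * (y x * cnj (D1 l w x)) + (-1) * (D1 l y x * cnj (w x)))"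
      by (intro abs_cont_on_lincomb abs_cont_on_mult abs_cont_on_cnj AC2_loc_abs_cont y w)
    then show ?thesis by (simp add: wronskian_def[abs_def])
  qed
  have int: "integrable (lebesgue_on {l..}) ?G"
    by (intro Bochner_Integration.integrable_diff L2_integrable_mult_cnj y w)
  then have setint: "set_integrable lebesgue {l..} ?G"
    by (simp add: set_integrable_def integrable_restrict_space)
  have ev: "(LINT x:{l..b}|lebesgue. ?G x) = wronskian l y w b - wronskian l y w l" if "l \<le> b" for b
  proof -
    have "(?G has_integral (wronskian l y w b - wronskian l y w l)) {l..b}"
    proof (rule abs_cont_fundamental_theorem[OF AC that])
      show "negligible N" using N(1) by (simp add: negligible_iff_null_sets)
      fix x assume "x \<in> {l..b} - N"
      then have "(wronskian l y w has_vector_derivative ?G x) (at x within {l..})" using N(2) by auto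
      then show "(wronskian l y w has_vector_derivative ?G x) (at x within {l..b})"
        by (rule has_vector_derivative_within_subset) auto
    qed
    moreover have "set_integrable lebesgue {l..b} ?G"
      by (rule set_integrable_subset[OF setint]) auto
    ultimately show ?thesis
      using set_lebesgue_integral_eq_integral(2) integral_unique by metis
  qed
  have "((\<lambda>b. LINT x:{l..b}|lebesgue. ?G x) \<longlongrightarrow> (LINT x:{l..}|lebesgue. ?G x)) at_top"
    by (rule tendsto_set_lebesgue_integral_at_top[OF _ setint]) auto
  moreover have "(LINT x:{l..}|lebesgue. ?G x) = ip l (schr_expr l q y) w - ip l y (schr_expr l q w)"
    unfolding ip_def set_lebesgue_integral_def
    by (subst Bochner_Integration.integral_diff[symmetric]) (auto intro: L2_integrable_mult_cnj y w simp: integral_restrict_space)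
  ultimately have "((\<lambda>b. wronskian l y w l + (LINT x:{l..b}|lebesgue. ?G x)) \<longlongrightarrow>
      wronskian l y w l + (ip l (schr_expr l q y) w - ip l y (schr_expr l q w))) at_top"
    by (intro tendsto_intros) simp
  moreover have "eventually (\<lambda>b. wronskian l y w l + (LINT x:{l..b}|lebesgue. ?G x) = wronskian l y w b) at_top"
    using eventually_ge_at_top[of l] by eventually_elim (simp add: ev)
  ultimately show ?thesis
    unfolding add_diff_eq by (rule Lim_transform_eventually)
qed

text \<open>
  The truncated powers are the source of the cut-off function below: the third one is twice
  continuously differentiable.
\<close>

lemma max_power_has_derivative:
  fixes s :: real
  assumes "2 \<le> n"
  shows "((\<lambda>s. max 0 s ^ n) has_real_derivative real n * max 0 s ^ (n - 1)) (at s)"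
proof (cases s "0::real" rule: linorder_cases)
  case less
  have "((\<lambda>s. 0) has_real_derivative 0) (at s)" by simp
  then have "((\<lambda>s. max 0 s ^ n) has_real_derivative 0) (at s)"
    by (rule has_field_derivative_transform_within_open[of _ _ _ "{..<0}"]) (use less assms in auto)
  then show ?thesis using less assms by (simp add: power_0_left)
next
  case greater
  have "((\<lambda>s. s ^ n) has_real_derivative real n * s ^ (n - 1)) (at s)"
    by (auto intro!: derivative_eq_intros)
  then have "((\<lambda>s. max 0 s ^ n) has_real_derivative real n * s ^ (n - 1)) (at s)"
    by (rule has_field_derivative_transform_within_open[of _ _ _ "{0<..}"]) (use greater in auto)
  then show ?thesis using greater by simp
next
  case equal
  have "((\<lambda>h. (max 0 (0 + h) ^ n - max 0 0 ^ n) / h) \<longlongrightarrow> 0) (at (0::real))"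
  proof (rule Lim_null_comparison[where g = "\<lambda>h. \<bar>h\<bar> ^ (n - 1)"])
    have "norm ((max 0 (0 + h) ^ n - max 0 0 ^ n) / h) \<le> \<bar>h\<bar> ^ (n - 1)" for h :: real
    proof (cases "h \<le> 0")
      case False
      then have "h ^ n / h = h ^ (n - 1)"
        using assms by (simp add: power_diff)
      then show ?thesis using False assms by (simp add: power_0_left)
    qed (use assms in auto)
    then show "eventually (\<lambda>h. norm ((max 0 (0 + h) ^ n - max 0 0 ^ n) / h) \<le> \<bar>h\<bar> ^ (n - 1)) (at (0::real))"
      by simp
    have "((\<lambda>h. \<bar>h\<bar> ^ (n - 1)) \<longlongrightarrow> \<bar>0\<bar> ^ (n - 1)) (at (0::real))"
      by (intro tendsto_intros)
    moreover have "\<bar>0 :: real\<bar> ^ (n - 1) = 0" using assms by simp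
    ultimately show "((\<lambda>h. \<bar>h\<bar> ^ (n - 1)) \<longlongrightarrow> 0) (at (0::real))" by (simp only:)
  qed
  then show ?thesis using equal assms by (simp add: has_field_derivative_iff power_0_left)
qed

lemma cutoff_function:
  fixes l e :: real
  assumes "e > 0"
  obtains \<kappa> \<kappa>' \<kappa>'' :: "real \<Rightarrow> real"
  where "\<And>x. (\<kappa> has_real_derivative \<kappa>' x) (at x)" "\<And>x. (\<kappa>' has_real_derivative \<kappa>'' x) (at x)"
    "continuous_on UNIV \<kappa>''" "\<kappa> l = 1" "\<kappa>' l = 0" "\<And>x. 0 \<le> \<kappa> x \<and> \<kappa> x \<le> 1"
    "\<And>x. l + e \<le> x \<Longrightarrow> \<kappa> x = 0 \<and> \<kappa>' x = 0 \<and> \<kappa>'' x = 0"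
proof
  define u where "u = (\<lambda>x. 1 - ((x - l) / e)\<^sup>2)"
  define u' where "u' = (\<lambda>x. (- 2 / e\<^sup>2) * (x - l))"
  have u: "(u has_real_derivative u' x) (at x)" for x
    unfolding u_def u'_def using assms
    by (auto intro!: derivative_eq_intros simp: power2_eq_square field_simps)
  have u': "(u' has_real_derivative - 2 / e\<^sup>2) (at x)" for x
    using DERIV_cmult[OF DERIV_diff[OF DERIV_ident DERIV_const], of "- 2 / e\<^sup>2"] by (simp add: u'_def)
  let ?\<kappa> = "\<lambda>x. max 0 (u x) ^ 3"
  let ?\<kappa>' = "\<lambda>x. 3 * max 0 (u x) ^ 2 * u' x"
  let ?\<kappa>'' = "\<lambda>x. 6 * max 0 (u x) * (u' x)\<^sup>2 - 6 * max 0 (u x) ^ 2 / e\<^sup>2"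
  have p: "((\<lambda>x. max 0 (u x) ^ n) has_real_derivative real n * max 0 (u x) ^ (n - 1) * u' x) (at x)"
    if "2 \<le> n" for n x
    using DERIV_chain2[OF max_power_has_derivative[OF that, of "u x"] u] .
  show "(?\<kappa> has_real_derivative ?\<kappa>' x) (at x)" for x
    using p[of 3 x] by simp
  have "((\<lambda>x. max 0 (u x) ^ 2) has_real_derivative 2 * max 0 (u x) * u' x) (at x)" for x
    using p[of 2 x] by simp
  from DERIV_mult[OF DERIV_cmult[OF this, of 3] u']
  show "(?\<kappa>' has_real_derivative ?\<kappa>'' x) (at x)" for x
    by (simp add: power2_eq_square algebra_simps)
  show "continuous_on UNIV ?\<kappa>''"
    unfolding u_def u'_def using assms by (intro continuous_intros) auto
  show "?\<kappa> l = 1" "?\<kappa>' l = 0" using assms by (simp_all add: u_def u'_def)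
  show "0 \<le> ?\<kappa> x \<and> ?\<kappa> x \<le> 1" for x
    by (auto simp: u_def intro!: power_le_one)
  show "?\<kappa> x = 0 \<and> ?\<kappa>' x = 0 \<and> ?\<kappa>'' x = 0" if "l + e \<le> x" for x
  proof -
    have "1 \<le> (x - l) / e" using that assms by (simp add: field_simps)
    then have "1 \<le> ((x - l) / e)\<^sup>2" by simp
    then have "u x \<le> 0" by (simp add: u_def)
    then show ?thesis by simp
  qed
qed

lemma L2_bounded_support:
  assumes f: "f \<in> borel_measurable (lebesgue_on {l..})" and c: "l \<le> c"
    and B: "\<And>x. x \<in> {l..c} \<Longrightarrow> cmod (f x) \<le> B" and z: "\<And>x. c < x \<Longrightarrow> f x = 0"
  shows "f \<in> L2 l" "Re (ip l f f) \<le> B\<^sup>2 * (c - l)"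
proof -
  note [measurable] = f
  have eq: "indicat_real {l..} x * indicat_real {l..c} x = indicat_real {l..c} x" for x
    by (simp add: indicator_def)
  have "integrable lebesgue (indicat_real {l..c})"
    using c by (intro integrable_real_indicator) auto
  then have ind: "integrable (lebesgue_on {l..}) (\<lambda>x. B\<^sup>2 * indicat_real {l..c} x)"
    by (intro integrable_mult_right) (simp add: integrable_restrict_space eq)
  have le: "(cmod (f x))\<^sup>2 \<le> B\<^sup>2 * indicat_real {l..c} x" if "x \<in> space (lebesgue_on {l..})" for x
    using that B[of x] z[of x] by (cases "x \<le> c") (auto simp: indicator_def intro!: power_mono)
  have int: "integrable (lebesgue_on {l..}) (\<lambda>x. (cmod (f x))\<^sup>2)"
    by (rule Bochner_Integration.integrable_bound[OF ind]) (auto intro!: AE_I2 le)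
  then show "f \<in> L2 l" using f by (simp add: L2_def)
  have "Re (ip l f f) = (LINT x|lebesgue_on {l..}. (cmod (f x))\<^sup>2)" by (simp add: ip_self)
  also have "\<dots> \<le> (LINT x|lebesgue_on {l..}. B\<^sup>2 * indicat_real {l..c} x)"
    by (rule integral_mono[OF int ind le])
  also have "\<dots> = B\<^sup>2 * (c - l)"
    using c by (simp add: measure_restrict_space Int_absorb1)
  finally show "Re (ip l f f) \<le> B\<^sup>2 * (c - l)" .
qed


text \<open>
  Multiplying a function of \<open>AC2\<close> by a cut-off function need not lead into \<open>D*\<close>, because \<open>q y\<close> is only
  locally summable. For a solution \<open>\<phi>\<close> it does: \<open>L (k \<phi>) = z k \<phi> - 2 k' \<phi>' - k'' \<phi>\<close> is free of \<open>q\<close>,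
  bounded and compactly supported.
\<close>

lemma cutoff_solution:
  assumes \<phi>: "solves l q z \<phi>" and "0 < e"
  obtains w where "w \<in> D_star l q" "w l = \<phi> l" "D1 l w l = D1 l \<phi> l"
    "\<And>x. l + 1 \<le> x \<Longrightarrow> w x = 0 \<and> D1 l w x = 0" "Re (ip l w w) < e"
proof -
  have AC: "\<phi> \<in> AC2 l" and eq: "AE x in lebesgue_on {l..}. schr_expr l q \<phi> x = z * \<phi> x"
    using \<phi> by (auto simp: solves_def)
  note cont = AC2_continuous_on[OF AC]
  have "continuous_on {l..l+1} \<phi>" by (rule continuous_on_subset[OF cont(1)]) auto
  from compact_imp_bounded[OF compact_continuous_image[OF this compact_Icc]]
  obtain B where B: "\<And>x. x \<in> {l..l+1} \<Longrightarrow> cmod (\<phi> x) \<le> B"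
    by (auto simp: bounded_iff simp del: atLeastAtMost_iff)
  then have "0 \<le> B" using norm_ge_zero order_trans by (metis atLeastAtMost_iff le_add_same_cancel1 order_refl zero_le_one)
  define d where "d = min 1 (e / (2 * (B\<^sup>2 + 1)))"
  have "0 < B\<^sup>2 + 1" by (simp add: add_nonneg_pos)
  then have d: "0 < d" "d \<le> 1" "d \<le> e / (2 * (B\<^sup>2 + 1))"
    using \<open>0 < e\<close> by (simp_all add: d_def)
  obtain k k' k'' :: "real \<Rightarrow> real"
    where k: "\<And>x. (k has_real_derivative k' x) (at x)" and k': "\<And>x. (k' has_real_derivative k'' x) (at x)"
    and k'': "continuous_on UNIV k''" and kl: "k l = 1" "k' l = 0" and k01: "\<And>x. 0 \<le> k x \<and> k x \<le> 1"
    and supp: "\<And>x. l + d \<le> x \<Longrightarrow> k x = 0 \<and> k' x = 0 \<and> k'' x = 0"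
    by (rule cutoff_function[OF d(1)]) blast
  let ?c = "complex_of_real"
  have vk: "((\<lambda>x. ?c (k x)) has_vector_derivative ?c (k' x)) (at x within S)"
    and vk': "((\<lambda>x. ?c (k' x)) has_vector_derivative ?c (k'' x)) (at x within S)" for x S
    using k[of x] k'[of x]
    by (auto intro!: has_vector_derivative_of_real simp: has_real_derivative_iff_has_vector_derivative
        has_vector_derivative_at_within)
  have ck: "continuous_on S (\<lambda>x. ?c (k x))" "continuous_on S (\<lambda>x. ?c (k' x))" "continuous_on S (\<lambda>x. ?c (k'' x))" for S
    unfolding continuous_on_eq_continuous_within
    using has_vector_derivative_continuous[OF vk] has_vector_derivative_continuous[OF vk']
      continuous_on_of_real[OF continuous_on_subset[OF k'' subset_UNIV]]
    unfolding continuous_on_eq_continuous_within by blast+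
  have ACk: "abs_cont_on l b (\<lambda>x. ?c (k x))" "abs_cont_on l b (\<lambda>x. ?c (k' x))" for b
    by (rule abs_cont_on_C1[OF vk ck(2)], rule abs_cont_on_C1[OF vk' ck(3)])
  define w where "w = (\<lambda>x. ?c (k x) * \<phi> x)"
  define w' where "w' = (\<lambda>x. ?c (k x) * D1 l \<phi> x + ?c (k' x) * \<phi> x)"
  define w'' where "w'' = (\<lambda>x. (?c (k x) * D1 l (D1 l \<phi>) x + ?c (k' x) * D1 l \<phi> x) + (?c (k' x) * D1 l \<phi> x + ?c (k'' x) * \<phi> x))"
  have w1: "(w has_vector_derivative w' x) (at x within {l..})" if "l \<le> x" for x
    unfolding w_def w'_def
    by (intro has_vector_derivative_mult vk AC2_has_derivative[OF AC that])
  have w2: "abs_cont_on l b w'" for b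
    using abs_cont_on_lincomb[OF abs_cont_on_mult[OF ACk(1) AC2_loc_abs_cont(2)[OF AC]]
        abs_cont_on_mult[OF ACk(2) AC2_loc_abs_cont(1)[OF AC]], of b 1 1]
    by (simp add: w'_def[abs_def])
  have w3: "AE x in lebesgue_on {l..}. (w' has_vector_derivative w'' x) (at x within {l..})"
    using AC2_has_second_derivative[OF AC] AE_space[of "lebesgue_on {l..}"]
  proof eventually_elim
    case (elim x)
    then have x: "l \<le> x" by simp
    show ?case unfolding w'_def w''_def
      by (intro has_vector_derivative_add has_vector_derivative_mult vk vk' AC2_has_derivative[OF AC x] elim)
  qed
  have wAC: "w \<in> AC2 l" by (rule AC2_I(1)[OF _ w2 w3]) (rule w1)
  have D1w: "D1 l w x = w' x" if "l \<le> x" for x by (rule AC2_I(2)[OF _ w2 w3 that]) (rule w1)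
  have D2w: "AE x in lebesgue_on {l..}. D1 l (D1 l w) x = w'' x" by (rule AC2_I(3)[OF _ w2 w3]) (rule w1)
  \<comment> \<open>The potential has been eliminated by means of the equation for \<open>\<phi>\<close>.\<close>
  define f where "f = (\<lambda>x. z * ?c (k x) * \<phi> x - 2 * ?c (k' x) * D1 l \<phi> x - ?c (k'' x) * \<phi> x)"
  have f: "AE x in lebesgue_on {l..}. f x = schr_expr l q w x"
    using D2w eq
  proof eventually_elim
    case (elim x)
    have "schr_expr l q w x = ?c (k x) * schr_expr l q \<phi> x - 2 * ?c (k' x) * D1 l \<phi> x - ?c (k'' x) * \<phi> x"
      using elim(1) by (simp add: schr_expr_def w''_def w_def algebra_simps)
    then show ?case using elim(2) by (simp add: f_def algebra_simps)
  qed
  have meas: "g \<in> borel_measurable (lebesgue_on {l..})" if "continuous_on {l..} g" for g :: "real \<Rightarrow> complex"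
    using that by (intro continuous_imp_measurable_on_sets_lebesgue) auto
  have cf: "continuous_on {l..} f" unfolding f_def by (intro continuous_intros cont ck)
  have cw: "continuous_on {l..} w" unfolding w_def by (intro continuous_intros cont ck)
  have "continuous_on {l..l+1} f" by (rule continuous_on_subset[OF cf]) auto
  from compact_imp_bounded[OF compact_continuous_image[OF this compact_Icc]]
  obtain A where A: "\<And>x. x \<in> {l..l+1} \<Longrightarrow> cmod (f x) \<le> A"
    by (auto simp: bounded_iff simp del: atLeastAtMost_iff)
  have "f \<in> L2 l"
    by (rule L2_bounded_support(1)[OF meas[OF cf] _ A]) (use supp d in \<open>auto simp: f_def\<close>)
  then have "schr_expr l q w \<in> L2 l" using L2_cong_AE f by blast
  moreover have wB: "cmod (w x) \<le> B" if "x \<in> {l..l+d}" for x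
  proof -
    have "cmod (w x) \<le> 1 * B"
      unfolding w_def norm_mult using that B[of x] k01[of x] d by (intro mult_mono) auto
    then show ?thesis by simp
  qed
  note wL2 = L2_bounded_support[OF meas[OF cw] _ wB]
  have "w \<in> L2 l" by (rule wL2(1)) (use supp d in \<open>auto simp: w_def\<close>)
  ultimately have "w \<in> D_star l q" using wAC by (simp add: D_star_def)
  moreover have "w l = \<phi> l" "D1 l w l = D1 l \<phi> l" using kl D1w[of l] by (simp_all add: w_def w'_def)
  moreover have "w x = 0 \<and> D1 l w x = 0" if "l + 1 \<le> x" for x
    using supp[of x] D1w[of x] d that by (simp add: w_def w'_def)
  moreover have "Re (ip l w w) < e"
  proof -
    have "Re (ip l w w) \<le> B\<^sup>2 * (l + d - l)" by (rule wL2(2)) (use supp d in \<open>auto simp: w_def\<close>)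
    also have "\<dots> \<le> (B\<^sup>2 + 1) * d" using d by (simp add: algebra_simps)
    also have "\<dots> \<le> (B\<^sup>2 + 1) * (e / (2 * (B\<^sup>2 + 1)))" using d \<open>0 < B\<^sup>2 + 1\<close> by (intro mult_left_mono) auto
    also have "\<dots> = e / 2"
    proof -
      have "c * (e / (2 * c)) = e / 2" if "0 < c" for c using that by simp
      from this[OF \<open>0 < B\<^sup>2 + 1\<close>] show ?thesis .
    qed
    also have "\<dots> < e" using \<open>0 < e\<close> by simp
    finally show ?thesis .
  qed
  ultimately show ?thesis using that by blast
qed

lemma solves_lincomb:
  assumes "solves l q z u" "solves l q z v"
  shows "solves l q z (\<lambda>x. a * u x + b * v x)"
proof -
  have u: "u \<in> AC2 l" "AE x in lebesgue_on {l..}. schr_expr l q u x = z * u x"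
    and v: "v \<in> AC2 l" "AE x in lebesgue_on {l..}. schr_expr l q v x = z * v x"
    using assms by (auto simp: solves_def)
  have "AE x in lebesgue_on {l..}. schr_expr l q (\<lambda>x. a * u x + b * v x) x = z * (a * u x + b * v x)"
    using u(2) v(2) AC2_lincomb(3)[OF u(1) v(1), of q a b] by eventually_elim (simp add: algebra_simps)
  then show ?thesis using AC2_lincomb(1)[OF u(1) v(1)] by (simp add: solves_def)
qed

lemma compactly_supported_boundary_values:
  assumes m: "weyl_function l q m" and "0 < e"
  obtains w where "w \<in> D_star l q" "w l = \<alpha>" "D1 l w l = \<beta>"
    "\<And>x. l + 1 \<le> x \<Longrightarrow> w x = 0 \<and> D1 l w x = 0" "Re (ip l w w) < e"
proof -
  have "\<exists>\<phi>1 \<phi>2. solves l q \<i> \<phi>1 \<and> \<phi>1 l = 0 \<and> D1 l \<phi>1 l = 1 \<and>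
                solves l q \<i> \<phi>2 \<and> \<phi>2 l = - 1 \<and> D1 l \<phi>2 l = 0 \<and>
                (\<lambda>x. \<phi>2 x + m \<i> * \<phi>1 x) \<in> L2 l"
    using m by (simp add: weyl_function_def)
  then obtain \<phi>1 \<phi>2 where 1: "solves l q \<i> \<phi>1" "\<phi>1 l = 0" "D1 l \<phi>1 l = 1"
    and 2: "solves l q \<i> \<phi>2" "\<phi>2 l = - 1" "D1 l \<phi>2 l = 0" by blast
  let ?\<phi> = "\<lambda>x. - \<alpha> * \<phi>2 x + \<beta> * \<phi>1 x"
  have "?\<phi> l = \<alpha>" "D1 l ?\<phi> l = \<beta>"
    using 1 2 AC2_lincomb(2)[of \<phi>2 l \<phi>1 l "- \<alpha>" \<beta>] by (auto simp: solves_def)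
  moreover obtain w where "w \<in> D_star l q" "w l = ?\<phi> l" "D1 l w l = D1 l ?\<phi> l"
    "\<And>x. l + 1 \<le> x \<Longrightarrow> w x = 0 \<and> D1 l w x = 0" "Re (ip l w w) < e"
    by (rule cutoff_solution[OF solves_lincomb[OF 2(1) 1(1)] \<open>0 < e\<close>]) blast
  ultimately show ?thesis by (intro that[of w]) simp_all
qed

text \<open>
  Near infinity \<open>y\<close> and \<open>w\<close> agree with members of the domain of the minimal operator, and for those
  the limit of the Wronskian is zero by symmetry and the Lagrange identity.
\<close>

theorem green_formula:
  assumes sym: "min_symmetric l q" and m: "weyl_function l q m"
    and y: "y \<in> D_star l q" and w: "w \<in> D_star l q"
  shows "ip l (schr_expr l q y) w - ip l y (schr_expr l q w) = D1 l y l * cnj (w l) - y l * cnj (D1 l w l)"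
proof -
  have sub: "\<exists>u0. u0 \<in> dom_min l q \<and> (\<forall>x\<ge>l+1. u0 x = u x \<and> D1 l u0 x = D1 l u x)"
    if u: "u \<in> D_star l q" for u
  proof -
    obtain v where v: "v \<in> D_star l q" "v l = u l" "D1 l v l = D1 l u l"
      "\<And>x. l + 1 \<le> x \<Longrightarrow> v x = 0 \<and> D1 l v x = 0"
      by (rule compactly_supported_boundary_values[OF m zero_less_one]) blast
    let ?u = "\<lambda>x. 1 * u x + (-1) * v x"
    note D1 = AC2_lincomb(2)[OF D_star_D(1)[OF u] D_star_D(1)[OF v(1)], of _ 1 "-1"]
    have "?u \<in> dom_min l q"
      using D_star_lincomb(1)[OF u v(1), of 1 "-1"] D1[of l] v by (simp add: dom_min_def)
    moreover have "\<forall>x\<ge>l+1. ?u x = u x \<and> D1 l ?u x = D1 l u x"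
      using v(4) D1 by simp
    ultimately show ?thesis by blast
  qed
  obtain y0 where y0: "y0 \<in> dom_min l q" "\<forall>x\<ge>l+1. y0 x = y x \<and> D1 l y0 x = D1 l y x" using sub[OF y] by blast
  obtain w0 where w0: "w0 \<in> dom_min l q" "\<forall>x\<ge>l+1. w0 x = w x \<and> D1 l w0 x = D1 l w x" using sub[OF w] by blast
  have "(wronskian l y0 w0 \<longlongrightarrow> wronskian l y0 w0 l + ip l (schr_expr l q y0) w0 - ip l y0 (schr_expr l q w0)) at_top"
    using y0 w0 by (intro lagrange_identity) (auto simp: dom_min_def)
  moreover have "wronskian l y0 w0 l = 0" using y0 w0 by (simp add: wronskian_def dom_min_def)
  moreover have "ip l (schr_expr l q y0) w0 = ip l y0 (schr_expr l q w0)"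
    using sym y0 w0 by (simp add: min_symmetric_def)
  ultimately have "(wronskian l y0 w0 \<longlongrightarrow> 0) at_top" by simp
  moreover have "eventually (\<lambda>x. wronskian l y0 w0 x = wronskian l y w x) at_top"
    using eventually_ge_at_top[of "l+1"] by eventually_elim (use y0 w0 in \<open>simp add: wronskian_def\<close>)
  ultimately have "(wronskian l y w \<longlongrightarrow> 0) at_top" by (rule Lim_transform_eventually)
  from tendsto_unique[OF _ this lagrange_identity[OF y w]]
  have "0 = wronskian l y w l + ip l (schr_expr l q y) w - ip l y (schr_expr l q w)" by simp
  then show ?thesis by (simp add: wronskian_def algebra_simps)
qed

section \<open>Hermitian resolvent equations\<close>

text \<open>
  The abstract form of \<open>(A - z) Y(z) = g\<close> for a Hermitian operator \<open>A\<close> given by a form \<open>S\<close>, where \<open>g\<close> is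
  a functional on \<open>D\<close> that need not be continuous in the norm of \<open>H\<close>. The inner product \<open>G\<close> may be
  degenerate, since functions are not identified when they agree almost everywhere.
\<close>

locale hermitian_resolvent =
  fixes H D :: "('x \<Rightarrow> complex) set"
    and G S :: "('x \<Rightarrow> complex) \<Rightarrow> ('x \<Rightarrow> complex) \<Rightarrow> complex"
    and g :: "('x \<Rightarrow> complex) \<Rightarrow> complex"
    and Y :: "complex \<Rightarrow> 'x \<Rightarrow> complex"
  assumes D_subset: "u \<in> D \<Longrightarrow> u \<in> H"
    and H_lincomb: "u \<in> H \<Longrightarrow> v \<in> H \<Longrightarrow> (\<lambda>x. a * u x + b * v x) \<in> H"
    and D_lincomb: "u \<in> D \<Longrightarrow> v \<in> D \<Longrightarrow> (\<lambda>x. a * u x + b * v x) \<in> D"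
    and G_lincomb: "u \<in> H \<Longrightarrow> v \<in> H \<Longrightarrow> w \<in> H \<Longrightarrow> G (\<lambda>x. a * u x + b * v x) w = a * G u w + b * G v w"
    and G_hermitian: "u \<in> H \<Longrightarrow> v \<in> H \<Longrightarrow> G v u = cnj (G u v)"
    and G_pos: "u \<in> H \<Longrightarrow> 0 \<le> Re (G u u)"
    and S_lincomb: "u \<in> D \<Longrightarrow> v \<in> D \<Longrightarrow> w \<in> D \<Longrightarrow> S (\<lambda>x. a * u x + b * v x) w = a * S u w + b * S v w"
    and S_hermitian: "u \<in> D \<Longrightarrow> v \<in> D \<Longrightarrow> S v u = cnj (S u v)"
    and Y_in_D: "Im z \<noteq> 0 \<Longrightarrow> Y z \<in> D"
    and Y_resolvent: "Im z \<noteq> 0 \<Longrightarrow> w \<in> D \<Longrightarrow> S (Y z) w - z * G (Y z) w = g w"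
begin

definition V :: "complex \<Rightarrow> complex" where "V z = cnj (g (Y z))"

definition nrm :: "('x \<Rightarrow> complex) \<Rightarrow> real" where "nrm u = sqrt (Re (G u u))"

lemma nrm_nonneg: "u \<in> H \<Longrightarrow> 0 \<le> nrm u"
  by (simp add: nrm_def G_pos)

lemma nrm_squared: "u \<in> H \<Longrightarrow> (nrm u)\<^sup>2 = Re (G u u)"
  by (simp add: nrm_def G_pos)

lemma G_self: "u \<in> H \<Longrightarrow> G u u = of_real ((nrm u)\<^sup>2)"
  using arg_cong[OF G_hermitian[of u u], of Im] by (simp add: complex_eq_iff nrm_squared)

lemma G_lincomb_right:
  assumes "u \<in> H" "v \<in> H" "w \<in> H"
  shows "G w (\<lambda>x. a * u x + b * v x) = cnj a * G w u + cnj b * G w v"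
  using G_hermitian[OF H_lincomb[OF assms(1,2), of a b] assms(3)] G_lincomb[OF assms, of a b]
    G_hermitian[OF assms(1,3)] G_hermitian[OF assms(2,3)]
  by simp

lemma nrm_squared_lincomb:
  assumes u: "u \<in> H" and v: "v \<in> H"
  shows "(nrm (\<lambda>x. a * u x + b * v x))\<^sup>2 =
    (cmod a)\<^sup>2 * (nrm u)\<^sup>2 + (cmod b)\<^sup>2 * (nrm v)\<^sup>2 + 2 * Re (a * cnj b * G u v)"
proof -
  let ?w = "\<lambda>x. a * u x + b * v x"
  note w = H_lincomb[OF u v, of a b]
  have "G ?w ?w = a * cnj a * G u u + b * cnj b * G v v + (a * cnj b * G u v + cnj (a * cnj b * G u v))"
    by (simp add: G_lincomb[OF u v w] G_lincomb_right[OF u v] u v G_hermitian[OF u v] algebra_simps)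
  also have "\<dots> = of_real ((cmod a)\<^sup>2 * (nrm u)\<^sup>2 + (cmod b)\<^sup>2 * (nrm v)\<^sup>2 + 2 * Re (a * cnj b * G u v))"
    by (simp only: complex_norm_square[symmetric] G_self[OF u] G_self[OF v] complex_add_cnj
        of_real_add of_real_mult of_real_power of_real_numeral)
  finally have "complex_of_real ((nrm ?w)\<^sup>2) = of_real ((cmod a)\<^sup>2 * (nrm u)\<^sup>2 + (cmod b)\<^sup>2 * (nrm v)\<^sup>2 + 2 * Re (a * cnj b * G u v))"
    by (simp only: G_self[OF w])
  then show ?thesis by (simp only: of_real_eq_iff)
qed

text \<open>
  Positivity on \<open>u - s G(u, v) v\<close> for all real \<open>s\<close>, which also settles the case \<open>G(v, v) = 0\<close>.
\<close>

lemma cauchy_schwarz: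
  assumes u: "u \<in> H" and v: "v \<in> H"
  shows "cmod (G u v) \<le> nrm u * nrm v"
proof -
  let ?c = "(cmod (G u v))\<^sup>2"
  have quad: "0 \<le> (nrm u)\<^sup>2 - 2 * s * ?c + s\<^sup>2 * ?c * (nrm v)\<^sup>2" for s :: real
  proof -
    have "Re (1 * cnj (of_real (- s) * G u v) * G u v) = - s * ?c"
      by (simp add: cmod_power2) (simp add: power2_eq_square algebra_simps)
    then have "(nrm (\<lambda>x. 1 * u x + (of_real (- s) * G u v) * v x))\<^sup>2 = (nrm u)\<^sup>2 + s\<^sup>2 * ?c * (nrm v)\<^sup>2 - 2 * s * ?c"
      unfolding nrm_squared_lincomb[OF u v] by (simp add: norm_mult power_mult_distrib)
    then show ?thesis using zero_le_power2[of "nrm (\<lambda>x. 1 * u x + (of_real (- s) * G u v) * v x)"] by linarith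
  qed
  have "?c \<le> (nrm u * nrm v)\<^sup>2"
  proof (cases "nrm v = 0")
    case True
    have "?c = 0"
    proof (rule ccontr)
      assume "?c \<noteq> 0"
      then show False using quad[of "((nrm u)\<^sup>2 + 1) / (2 * ?c)"] True by simp
    qed
    then show ?thesis by simp
  next
    case False
    then have pos: "0 < (nrm v)\<^sup>2" by simp
    have "(1 / N)\<^sup>2 * c * N = c / N" if "0 < N" for c N :: real
      using that by (simp add: power2_eq_square)
    from this[OF pos, of ?c] have "0 \<le> (nrm u)\<^sup>2 - ?c / (nrm v)\<^sup>2"
      using quad[of "1 / (nrm v)\<^sup>2"] by simp
    then show ?thesis using pos by (simp add: field_simps power_mult_distrib)
  qed
  then show ?thesis
    by (rule power2_le_imp_le) (simp add: nrm_nonneg u v)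
qed

lemma nrm_squared_add_le:
  assumes u: "u \<in> H" and v: "v \<in> H"
  shows "(nrm (\<lambda>x. a * u x + b * v x))\<^sup>2 \<le> 2 * (cmod a)\<^sup>2 * (nrm u)\<^sup>2 + 2 * (cmod b)\<^sup>2 * (nrm v)\<^sup>2"
proof -
  have "0 \<le> (nrm (\<lambda>x. a * u x + (- b) * v x))\<^sup>2" by simp
  then show ?thesis
    unfolding nrm_squared_lincomb[OF u v] by simp
qed

text \<open>
  The bound \<open>1/|Im z|\<close> for the resolvent of a Hermitian operator: take imaginary parts of the equation
  tested with \<open>d\<close> itself, where \<open>S d d\<close> is real.
\<close>

lemma resolvent_bound:
  assumes d: "d \<in> D" and f: "f \<in> H" and eq: "\<And>w. w \<in> D \<Longrightarrow> S d w - z * G d w = G f w"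
  shows "\<bar>Im z\<bar> * nrm d \<le> nrm f"
proof -
  note dH = D_subset[OF d]
  have "Im (S d d) = 0" using arg_cong[OF S_hermitian[OF d d], of Im] by simp
  then have "Im (G f d) = - Im z * (nrm d)\<^sup>2"
    using arg_cong[OF eq[OF d], of Im] by (simp add: G_self[OF dH])
  then have "\<bar>Im z\<bar> * (nrm d)\<^sup>2 = \<bar>Im (G f d)\<bar>" by (simp add: abs_mult)
  also have "\<dots> \<le> nrm f * nrm d"
    using abs_Im_le_cmod cauchy_schwarz[OF f dH] by (rule order_trans)
  finally have "(\<bar>Im z\<bar> * nrm d) * nrm d \<le> nrm f * nrm d" by (simp add: power2_eq_square mult.assoc)
  then show ?thesis
    using nrm_nonneg[OF dH] nrm_nonneg[OF f] by (cases "nrm d = 0") auto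
qed

text \<open>
  Testing the equation for \<open>y\<close> with \<open>Y (cnj z)\<close> and the equation for \<open>Y (cnj z)\<close> with \<open>y\<close> gives the same
  number. In particular the value of \<open>V\<close> does not depend on the choice of the solution.
\<close>

lemma V_eq_any_solution:
  assumes z: "Im z \<noteq> 0" and y: "y \<in> D" and eq: "\<And>w. w \<in> D \<Longrightarrow> S y w - z * G y w = g w"
  shows "cnj (g y) = g (Y (cnj z))"
proof -
  have z': "Im (cnj z) \<noteq> 0" using z by simp
  note Y = Y_in_D[OF z']
  have "cnj (g y) = cnj (S (Y (cnj z)) y - cnj z * G (Y (cnj z)) y)"
    by (simp add: Y_resolvent[OF z' y])
  also have "\<dots> = S y (Y (cnj z)) - z * G y (Y (cnj z))"
    using S_hermitian[OF y Y] G_hermitian[OF D_subset[OF y] D_subset[OF Y]] by simp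
  finally show ?thesis by (simp add: eq[OF Y])
qed

lemma V_eq: "Im z \<noteq> 0 \<Longrightarrow> V z = g (Y (cnj z))"
  unfolding V_def by (rule V_eq_any_solution) (auto intro: Y_in_D Y_resolvent)

lemma V_eq_solution:
  assumes z: "Im z \<noteq> 0" and y: "y \<in> D" and eq: "\<And>w. w \<in> D \<Longrightarrow> S y w - z * G y w = g w"
  shows "V z = cnj (g y)"
  using V_eq[OF z] V_eq_any_solution[OF assms] by simp

text \<open>
  The resolvent identity. The equations for \<open>Y z\<close> and \<open>Y (cnj u)\<close>, each tested with the other solution,
  express \<open>V z\<close> and \<open>V u\<close> by the same two numbers.
\<close>

lemma V_difference:
  assumes z: "Im z \<noteq> 0" and u: "Im u \<noteq> 0"
  shows "V z - V u = (z - u) * G (Y z) (Y (cnj u))"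
proof -
  have u': "Im (cnj u) \<noteq> 0" using u by simp
  note Yz = Y_in_D[OF z] and Yu = Y_in_D[OF u']
  have "V z = cnj (S (Y (cnj u)) (Y z) - cnj u * G (Y (cnj u)) (Y z))"
    by (simp add: Y_resolvent[OF u' Yz] V_def)
  also have "\<dots> = S (Y z) (Y (cnj u)) - u * G (Y z) (Y (cnj u))"
    using S_hermitian[OF Yz Yu] G_hermitian[OF D_subset[OF Yz] D_subset[OF Yu]] by simp
  finally have 1: "V z = S (Y z) (Y (cnj u)) - u * G (Y z) (Y (cnj u))" .
  have 2: "V u = S (Y z) (Y (cnj u)) - z * G (Y z) (Y (cnj u))"
    using V_eq[OF u] Y_resolvent[OF z Yu] by simp
  show ?thesis unfolding 1 2 by (simp add: algebra_simps)
qed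

lemma Im_V:
  assumes z: "Im z \<noteq> 0"
  shows "Im (V z) = Im z * (nrm (Y z))\<^sup>2"
proof -
  have z': "Im (cnj z) \<noteq> 0" using z by simp
  have "V (cnj z) = cnj (V z)" using V_eq[OF z'] by (simp add: V_def)
  then have "V z - cnj (V z) = (z - cnj z) * of_real ((nrm (Y z))\<^sup>2)"
    using V_difference[OF z z'] G_self[OF D_subset[OF Y_in_D[OF z]]] by simp
  from arg_cong[OF this, of Im] show ?thesis by simp
qed

lemma V_has_field_derivative:
  assumes u: "Im u > 0"
  shows "(V has_field_derivative G (Y u) (Y (cnj u))) (at u)"
  unfolding has_field_derivative_iff
proof (rule Lim_transform_eventually)
  have u0: "Im u \<noteq> 0" "Im (cnj u) \<noteq> 0" using u by auto
  note Yu = Y_in_D[OF u0(1)] and Ycu = Y_in_D[OF u0(2)]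
  have ev: "eventually (\<lambda>z. Im z > 0 \<and> z \<noteq> u) (at u)"
  proof -
    have "open {z. Im z > 0}" by (simp add: open_halfspace_Im_gt)
    then show ?thesis
      unfolding eventually_at_topological using u by blast
  qed
  show "eventually (\<lambda>z. G (Y z) (Y (cnj u)) = (V z - V u) / (z - u)) (at u)"
    using ev by eventually_elim (use u0 in \<open>simp add: V_difference\<close>)
  have "((\<lambda>z. G (Y z) (Y (cnj u)) - G (Y u) (Y (cnj u))) \<longlongrightarrow> 0) (at u)"
  proof (rule Lim_null_comparison)
    show "eventually (\<lambda>z. norm (G (Y z) (Y (cnj u)) - G (Y u) (Y (cnj u))) \<le>
        cmod (z - u) * nrm (Y u) / \<bar>Im z\<bar> * nrm (Y (cnj u))) (at u)"
      using ev
    proof eventually_elim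
      case (elim z)
      then have z: "Im z \<noteq> 0" by simp
      note Yz = Y_in_D[OF z]
      let ?d = "\<lambda>x. 1 * Y z x + (-1) * Y u x" and ?f = "\<lambda>x. (z - u) * Y u x + 0 * Y u x"
      note d = D_lincomb[OF Yz Yu, of 1 "-1"] and f = D_lincomb[OF Yu Yu, of "z - u" 0]
      have "S ?d w - z * G ?d w = G ?f w" if w: "w \<in> D" for w
        using Y_resolvent[OF z w] Y_resolvent[OF u0(1) w]
        unfolding S_lincomb[OF Yz Yu w] G_lincomb[OF D_subset[OF Yz] D_subset[OF Yu] D_subset[OF w]]
          G_lincomb[OF D_subset[OF Yu] D_subset[OF Yu] D_subset[OF w]]
        by (simp add: algebra_simps)
      from resolvent_bound[OF d D_subset[OF f] this]
      have "\<bar>Im z\<bar> * nrm ?d \<le> nrm ?f" .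
      moreover have "(nrm ?f)\<^sup>2 = (cmod (z - u) * nrm (Y u))\<^sup>2"
        unfolding nrm_squared_lincomb[OF D_subset[OF Yu] D_subset[OF Yu]] by (simp add: power_mult_distrib)
      then have "nrm ?f = cmod (z - u) * nrm (Y u)"
        by (rule power2_eq_imp_eq)
          (use nrm_nonneg[OF D_subset[OF f]] nrm_nonneg[OF D_subset[OF Yu]] in simp_all)
      ultimately have "nrm ?d \<le> cmod (z - u) * nrm (Y u) / \<bar>Im z\<bar>"
        using z by (simp add: field_simps)
      then have "nrm ?d * nrm (Y (cnj u)) \<le> cmod (z - u) * nrm (Y u) / \<bar>Im z\<bar> * nrm (Y (cnj u))"
        by (rule mult_right_mono) (simp add: nrm_nonneg D_subset Ycu)
      moreover have "G (Y z) (Y (cnj u)) - G (Y u) (Y (cnj u)) = G ?d (Y (cnj u))"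
        unfolding G_lincomb[OF D_subset[OF Yz] D_subset[OF Yu] D_subset[OF Ycu]] by simp
      ultimately show ?case
        using cauchy_schwarz[OF D_subset[OF d] D_subset[OF Ycu]] by simp
    qed
    have "((\<lambda>z. cmod (z - u) * nrm (Y u) / \<bar>Im z\<bar> * nrm (Y (cnj u))) \<longlongrightarrow>
        cmod (u - u) * nrm (Y u) / \<bar>Im u\<bar> * nrm (Y (cnj u))) (at u)"
      by (intro tendsto_intros) (use u in auto)
    then show "((\<lambda>z. cmod (z - u) * nrm (Y u) / \<bar>Im z\<bar> * nrm (Y (cnj u))) \<longlongrightarrow> 0) (at u)" by simp
  qed
  then show "((\<lambda>z. G (Y z) (Y (cnj u))) \<longlongrightarrow> G (Y u) (Y (cnj u))) (at u)"
    by (simp add: LIM_zero_iff)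
qed

lemma V_analytic: "V analytic_on {z. Im z > 0}"
proof -
  have op: "open {z. Im z > 0}" by (simp add: open_halfspace_Im_gt)
  show ?thesis
    unfolding analytic_on_open[OF op] holomorphic_on_open[OF op]
    using V_has_field_derivative by blast
qed

text \<open>
  On elements where \<open>S w\<close> is represented by a vector of \<open>H\<close>, the functional \<open>g\<close> can be read off from \<open>Y z\<close>.
\<close>

lemma g_bound:
  assumes z: "Im z \<noteq> 0" and w: "w \<in> D" and f: "f \<in> H" and Sw: "\<And>v. v \<in> D \<Longrightarrow> S w v = G f v"
  shows "cmod (g w) \<le> nrm (Y z) * (nrm f + cmod z * nrm w)"
proof -
  note Y = Y_in_D[OF z]
  have "g w = G (Y z) f - z * G (Y z) w"
    using Y_resolvent[OF z w] S_hermitian[OF w Y] Sw[OF Y] G_hermitian[OF f D_subset[OF Y]] by simp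
  then have "cmod (g w) \<le> cmod (G (Y z) f) + cmod z * cmod (G (Y z) w)"
    by (metis norm_mult norm_triangle_ineq4)
  also have "\<dots> \<le> nrm (Y z) * nrm f + cmod z * (nrm (Y z) * nrm w)"
    by (intro add_mono mult_left_mono cauchy_schwarz) (simp_all add: D_subset Y w f)
  finally show ?thesis by (simp add: algebra_simps)
qed

lemma Im_V_pos:
  assumes z: "Im z > 0" and w: "w \<in> D" "g w \<noteq> 0" and f: "f \<in> H" and Sw: "\<And>v. v \<in> D \<Longrightarrow> S w v = G f v"
  shows "Im (V z) > 0"
proof -
  have z0: "Im z \<noteq> 0" using z by simp
  have "nrm (Y z) \<noteq> 0" using g_bound[OF z0 w(1) f Sw] w(2) by auto
  then show ?thesis using z by (simp add: Im_V)
qed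

text \<open>
  The quotient is \<open>||Y(iT)||\<^sup>2\<close>. If \<open>Y(i) = w + c\<close> with \<open>w\<close> in the domain of the operator and \<open>c\<close>
  small, then \<open>Y(iT) - c\<close> solves a resolvent equation whose right-hand side is
  \<open>(f - i Y(i)) + iT c\<close>. By the resolvent bound its norm is at most \<open>O(1/T) + ||c||\<close>.
\<close>

lemma Im_V_decay:
  assumes approx: "\<And>\<epsilon>. 0 < \<epsilon> \<Longrightarrow> \<exists>c f. c \<in> D \<and> f \<in> H \<and> Re (G c c) < \<epsilon> \<and>
      (\<forall>v\<in>D. S (\<lambda>x. 1 * Y \<i> x + (-1) * c x) v = G f v)"
  shows "((\<lambda>T. Im (V (\<i> * of_real T)) / T) \<longlongrightarrow> 0) at_top"
proof (rule tendstoI)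
  fix e :: real assume "0 < e"
  then have "0 < e / 12" by simp
  from approx[OF this] obtain c f where c: "c \<in> D" and f: "f \<in> H" and ce: "Re (G c c) < e / 12"
    and Sw: "\<And>v. v \<in> D \<Longrightarrow> S (\<lambda>x. 1 * Y \<i> x + (-1) * c x) v = G f v" by blast
  note cH = D_subset[OF c]
  have Yi: "Y \<i> \<in> D" by (simp add: Y_in_D)
  note YiH = D_subset[OF Yi]
  have ce: "(nrm c)\<^sup>2 < e / 12" using ce by (simp add: nrm_squared cH)
  define f1 where "f1 = (\<lambda>x. 1 * f x + (- \<i>) * Y \<i> x)"
  have f1: "f1 \<in> H" unfolding f1_def by (rule H_lincomb[OF f YiH])
  define K where "K = (nrm f1)\<^sup>2"
  have bound: "(nrm (Y (\<i> * of_real T)))\<^sup>2 \<le> 6 * (nrm c)\<^sup>2 + 4 * K / T\<^sup>2" if T: "0 < T" for T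
  proof -
    let ?z = "\<i> * complex_of_real T"
    have z: "Im ?z \<noteq> 0" using T by simp
    note Yz = Y_in_D[OF z] note YzH = D_subset[OF Yz]
    let ?e = "\<lambda>x. 1 * Y ?z x + (-1) * c x" and ?F = "\<lambda>x. 1 * f1 x + ?z * c x"
    note e = D_lincomb[OF Yz c, of 1 "-1"] and F = H_lincomb[OF f1 cH, of 1 ?z]
    have "S ?e v - ?z * G ?e v = G ?F v" if v: "v \<in> D" for v
    proof -
      note vH = D_subset[OF v]
      have 1: "S (Y \<i>) v = G f v + S c v"
        using Sw[OF v] unfolding S_lincomb[OF Yi c v] by (simp add: algebra_simps)
      have 2: "g v = S (Y \<i>) v - \<i> * G (Y \<i>) v" by (rule Y_resolvent[symmetric]) (simp_all add: v)
      have 3: "S (Y ?z) v = g v + ?z * G (Y ?z) v" using Y_resolvent[OF z v] by (simp add: algebra_simps)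
      have 4: "G f1 v = G f v - \<i> * G (Y \<i>) v" unfolding f1_def G_lincomb[OF f YiH vH] by simp
      show ?thesis
        unfolding S_lincomb[OF Yz c v] G_lincomb[OF YzH cH vH] G_lincomb[OF f1 cH vH] 3 2 1 4
        by (simp add: algebra_simps)
    qed
    from resolvent_bound[OF e F this] have "T * nrm ?e \<le> nrm ?F" using T by simp
    then have "(T * nrm ?e)\<^sup>2 \<le> (nrm ?F)\<^sup>2"
      using T nrm_nonneg[OF D_subset[OF e]] by (intro power_mono mult_nonneg_nonneg) simp_all
    also have "\<dots> \<le> 2 * K + 2 * T\<^sup>2 * (nrm c)\<^sup>2"
      using nrm_squared_add_le[OF f1 cH, of 1 ?z] by (simp add: K_def norm_mult)
    finally have eb: "(nrm ?e)\<^sup>2 \<le> 2 * K / T\<^sup>2 + 2 * (nrm c)\<^sup>2"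
      using T by (simp add: field_simps power_mult_distrib)
    have Y_split: "Y ?z = (\<lambda>x. 1 * ?e x + 1 * c x)" by auto
    have "(nrm (Y ?z))\<^sup>2 \<le> 2 * (nrm ?e)\<^sup>2 + 2 * (nrm c)\<^sup>2"
      using nrm_squared_add_le[OF D_subset[OF e] cH, of 1 1] by (subst Y_split) simp
    moreover have "4 * K / T\<^sup>2 = 2 * (2 * K / T\<^sup>2)" by simp
    ultimately show ?thesis using eb by linarith
  qed
  have "((\<lambda>T. 4 * K / T\<^sup>2) \<longlongrightarrow> 0) at_top" by real_asymp
  then have "eventually (\<lambda>T. 4 * K / T\<^sup>2 < e / 2) at_top"
    using \<open>0 < e\<close> by (intro order_tendstoD) auto
  then show "eventually (\<lambda>T. dist (Im (V (\<i> * of_real T)) / T) 0 < e) at_top"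
    using eventually_gt_at_top[of 0]
  proof eventually_elim
    case (elim T)
    have "Im (V (\<i> * of_real T)) / T = (nrm (Y (\<i> * of_real T)))\<^sup>2" using elim(2) by (simp add: Im_V)
    then show ?case using bound[OF elim(2)] elim(1) ce by (simp add: dist_real_def)
  qed
qed

text \<open>
  A bound would make \<open>T ||Y(iT)||\<close> bounded, and then \<open>g_bound\<close> would make \<open>g\<close> continuous in the norm
  of \<open>H\<close>.
\<close>

lemma Im_V_unbounded:
  assumes \<gamma>: "\<gamma> \<noteq> 0"
    and approx: "\<And>\<epsilon>. 0 < \<epsilon> \<Longrightarrow> \<exists>w f. w \<in> D \<and> f \<in> H \<and> Re (G w w) < \<epsilon> \<and> g w = \<gamma> \<and> (\<forall>v\<in>D. S w v = G f v)"
  shows "\<exists>T>0. C < T * Im (V (\<i> * of_real T))"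
proof (rule ccontr)
  assume "\<not> ?thesis"
  then have C: "T * Im (V (\<i> * of_real T)) \<le> C" if "0 < T" for T using that by (meson not_le)
  define M where "M = sqrt (\<bar>C\<bar> + 1)"
  have M: "0 < M" by (simp add: M_def)
  have Yb: "T * nrm (Y (\<i> * of_real T)) \<le> M" if T: "0 < T" for T
  proof -
    have "(T * nrm (Y (\<i> * of_real T)))\<^sup>2 = T * Im (V (\<i> * of_real T))"
      using T by (simp add: Im_V power_mult_distrib power2_eq_square)
    also have "\<dots> \<le> M\<^sup>2" using C[OF T] by (simp add: M_def)
    finally show ?thesis by (rule power2_le_imp_le) (use M in simp)
  qed
  define d where "d = cmod \<gamma> / (2 * M)"
  have "0 < d" using M \<gamma> by (simp add: d_def)
  then obtain w f where w: "w \<in> D" "Re (G w w) < d\<^sup>2" "g w = \<gamma>" and f: "f \<in> H" and Sw: "\<And>v. v \<in> D \<Longrightarrow> S w v = G f v"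
    using approx[of "d\<^sup>2"] by (auto simp: zero_less_power)
  have "nrm w < d"
    by (rule power2_less_imp_less) (use w \<open>0 < d\<close> in \<open>simp_all add: nrm_squared D_subset\<close>)
  define T where "T = 2 * M * (nrm f + 1) / cmod \<gamma>"
  have f0: "0 \<le> nrm f" by (rule nrm_nonneg[OF f])
  have T: "0 < T" using M \<gamma> f0 by (simp add: T_def)
  have "cmod \<gamma> \<le> nrm (Y (\<i> * of_real T)) * (nrm f + T * nrm w)"
    using g_bound[OF _ w(1) f Sw, of "\<i> * of_real T"] w(3) T by (simp add: norm_mult)
  also have "\<dots> = (T * nrm (Y (\<i> * of_real T))) * (nrm f / T + nrm w)"
    using T by (simp add: field_simps)
  also have "\<dots> \<le> M * (nrm f / T + nrm w)"
    using Yb[OF T] f0 T nrm_nonneg[OF D_subset[OF w(1)]] by (intro mult_right_mono) auto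
  also have "\<dots> < M * ((nrm f + 1) / T + d)"
    using \<open>nrm w < d\<close> T M by (intro mult_strict_left_mono add_less_le_mono) (auto simp: divide_strict_right_mono)
  also have "(nrm f + 1) / T = d"
    using M \<gamma> add_nonneg_pos[OF f0 zero_less_one] by (simp add: T_def d_def)
  also have "M * (d + d) = cmod \<gamma>"
    using M by (simp add: d_def)
  finally show False by simp
qed

end

section \<open>The Herglotz representation\<close>

lemma Cauchy_integral_unit_circle:
  fixes F :: "complex \<Rightarrow> complex"
  assumes F: "F holomorphic_on cball 0 1" and w: "cmod w < 1"
  shows "((\<lambda>t. F (cis t) * (cis t / (cis t - w))) has_integral (2 * pi * F w)) {0..2*pi}"
proof -
  have "((\<lambda>u. F u / (u - w)) has_contour_integral (2 * pi * \<i> * F w)) (part_circlepath 0 1 0 (2 * pi))"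
    using Cauchy_integral_circlepath_simple[OF F, of w] w by (simp add: circlepath_def)
  then have "((\<lambda>t. F (cis t) / (cis t - w) * \<i> * cis t) has_integral (2 * pi * \<i> * F w)) {0..2*pi}"
    by (subst (asm) has_contour_integral_part_circlepath_iff) simp_all
  from has_integral_mult_right[OF this, of "- \<i>"] show ?thesis
    by (simp add: field_simps)
qed

text \<open>
  A holomorphic function is recovered from the boundary values of its real part. The Cauchy formula
  at \<open>w\<close> supplies \<open>F\<close>; the conjugate of the Cauchy formula at \<open>0\<close> for \<open>F(u)/(1 - cnj w u)\<close> supplies
  the conjugate of \<open>F\<close> against the same kernel, because \<open>cnj u = 1/u\<close> on the circle.
\<close>

lemma schwarz_integral_formula:
  fixes F :: "complex \<Rightarrow> complex"
  assumes F: "F holomorphic_on cball 0 1" and w: "cmod w < 1"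
  shows "((\<lambda>t. Re (F (cis t)) *\<^sub>R ((cis t + w) / (cis t - w))) has_integral
    (2 * pi * (F w - \<i> * Im (F 0)))) {0..2*pi}"
proof -
  have ne: "cis t \<noteq> w" "1 \<noteq> cnj w * cis t" for t
  proof -
    show "cis t \<noteq> w" using w norm_cis[of t] by auto
    have "cmod (cnj w * cis t) < 1" using w by (simp add: norm_mult)
    then show "1 \<noteq> cnj w * cis t" using norm_one by (metis less_irrefl)
  qed
  have K: "(\<lambda>u. F u / (1 - cnj w * u)) holomorphic_on cball 0 1"
  proof (intro holomorphic_intros F)
    fix u :: complex assume "u \<in> cball 0 1"
    then have "cmod (cnj w * u) < 1"
      using w mult_left_mono[of "cmod u" 1 "cmod w"] by (simp add: norm_mult) 
    then show "1 - cnj w * u \<noteq> 0" by auto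
  qed
  have "((\<lambda>t. F (cis t) / (1 - cnj w * cis t)) has_integral (2 * pi * F 0)) {0..2*pi}"
    using Cauchy_integral_unit_circle[OF K, of 0] by simp
  from has_integral_linear[OF this bounded_linear_cnj]
  have "((\<lambda>t. cnj (F (cis t) / (1 - cnj w * cis t))) has_integral (2 * pi * cnj (F 0))) {0..2*pi}"
    by (simp add: o_def)
  moreover have "cnj (F (cis t) / (1 - cnj w * cis t)) = cnj (F (cis t)) * (cis t / (cis t - w))" for t
  proof -
    have "cnj (cis t) * cis t = 1" by (simp add: cis_cnj cis_mult)
    then have "cis t - w = cis t * (1 - w * cnj (cis t))" by (simp add: algebra_simps)
    then have "cis t / (cis t - w) = 1 / (1 - w * cnj (cis t))" by simp
    then show ?thesis by simp
  qed
  ultimately have 1: "((\<lambda>t. cnj (F (cis t)) * (cis t / (cis t - w))) has_integral (2 * pi * cnj (F 0))) {0..2*pi}"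
    by simp
  have "((\<lambda>t. F (cis t)) has_integral (2 * pi * F 0)) {0..2*pi}"
    using Cauchy_integral_unit_circle[OF F, of 0] by simp
  from has_integral_linear[OF has_integral_Re[OF this] bounded_linear_of_real]
  have 2: "((\<lambda>t. complex_of_real (Re (F (cis t)))) has_integral (of_real (2 * pi * Re (F 0)))) {0..2*pi}"
    by (simp add: o_def)
  have "((\<lambda>t. F (cis t) * (cis t / (cis t - w)) + cnj (F (cis t)) * (cis t / (cis t - w)) - complex_of_real (Re (F (cis t))))
    has_integral (2 * pi * F w + 2 * pi * cnj (F 0) - of_real (2 * pi * Re (F 0)))) {0..2*pi}"
    by (intro has_integral_diff has_integral_add Cauchy_integral_unit_circle[OF F w] 1 2)
  moreover have "2 * pi * F w + 2 * pi * cnj (F 0) - of_real (2 * pi * Re (F 0)) = 2 * pi * (F w - \<i> * Im (F 0))"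
    by (simp add: complex_eq_iff algebra_simps)
  moreover have "F (cis t) * (cis t / (cis t - w)) + cnj (F (cis t)) * (cis t / (cis t - w)) - of_real (Re (F (cis t))) =
        Re (F (cis t)) *\<^sub>R ((cis t + w) / (cis t - w))" for t
  proof -
    have "F (cis t) * (cis t / (cis t - w)) + cnj (F (cis t)) * (cis t / (cis t - w)) =
        of_real (2 * Re (F (cis t))) * (cis t / (cis t - w))"
      by (simp only: distrib_right[symmetric] complex_add_cnj)
    also have "\<dots> - of_real (Re (F (cis t))) = of_real (Re (F (cis t))) * ((cis t + w) / (cis t - w))"
      using ne(1)[of t] by (simp add: field_simps)
    finally show ?thesis by (simp only: scaleR_conv_of_real)
  qed
  ultimately show ?thesis by (simp only:)
qed

lemma continuous_on_schwarz_kernel: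
  assumes "cmod w < 1"
  shows "continuous_on UNIV (\<lambda>t. (cis t + w) / (cis t - w))"
proof -
  have "cis t \<noteq> w" for t using assms norm_cis[of t] by auto
  then show ?thesis by (intro continuous_intros) auto
qed

lemma cmod_schwarz_kernel_le:
  assumes "cmod w < 1"
  shows "cmod ((cis t + w) / (cis t - w)) \<le> 2 / (1 - cmod w)"
proof -
  have "1 - cmod w \<le> cmod (cis t - w)" using norm_triangle_ineq2[of "cis t" w] by simp
  moreover have "cmod (cis t + w) \<le> 2" using norm_triangle_ineq[of "cis t" w] assms by simp
  ultimately show ?thesis unfolding norm_divide using assms by (intro frac_le) auto
qed

text \<open>
  For a function with nonnegative real part and value \<open>1\<close> at \<open>0\<close>, the boundary values of the real part
  are, up to the factor \<open>2 pi\<close>, a probability density. It is placed on \<open>[0, 2 pi]\<close> inside the line; \<open>{-1<..7}\<close> is a bounded half-open interval around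
  it, as the definition of tightness asks for.
\<close>

lemma circle_density:
  fixes F :: "complex \<Rightarrow> complex"
  assumes F: "F holomorphic_on cball 0 1" and pos: "\<And>w. w \<in> cball 0 1 \<Longrightarrow> 0 \<le> Re (F w)" and F0: "F 0 = 1"
  defines "\<nu> \<equiv> density lborel (\<lambda>t. ennreal (indicator {0..2*pi} t * (Re (F (cis t)) / (2 * pi))))"
  shows "real_distribution \<nu>" "measure \<nu> {-1<..7} = 1"
    "cmod w < 1 \<Longrightarrow> (LINT t|\<nu>. (cis t + w) / (cis t - w)) = F w"
proof -
  let ?d = "\<lambda>t. indicat_real {0..2*pi} t * (Re (F (cis t)) / (2 * pi))"
  have cF: "continuous_on S (\<lambda>t. Re (F (cis t)))" for S
  proof -
    have "continuous_on S (\<lambda>t. F (cis t))"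
      by (rule continuous_on_compose2[OF holomorphic_on_imp_continuous_on[OF F]])
        (auto intro!: continuous_intros)
    then show ?thesis by (rule continuous_on_Re)
  qed
  have [measurable]: "(\<lambda>t. Re (F (cis t))) \<in> borel_measurable borel"
    using cF by (rule borel_measurable_continuous_onI)
  have d0: "0 \<le> ?d t" for t using pos[of "cis t"] by simp
  have integral_eq: "(LINT t|\<nu>. k t) = I" if k: "continuous_on UNIV k"
      and I: "((\<lambda>t. Re (F (cis t)) *\<^sub>R k t) has_integral (2 * pi * I)) {0..2*pi}"
    for k :: "real \<Rightarrow> complex" and I :: complex
  proof -
    have [measurable]: "k \<in> borel_measurable borel" using k by (rule borel_measurable_continuous_onI)
    have ck: "continuous_on {0..2*pi} (\<lambda>t. Re (F (cis t)) *\<^sub>R k t)"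
      using continuous_on_subset[OF k] by (intro continuous_intros cF) auto
    have si: "set_integrable lborel {0..2*pi} (\<lambda>t. Re (F (cis t)) *\<^sub>R k t)"
      unfolding set_integrable_def by (rule borel_integrable_compact[OF compact_Icc ck])
    have "(LINT t|\<nu>. k t) = (LINT t|lborel. ?d t *\<^sub>R k t)"
      unfolding \<nu>_def by (rule integral_density) (use d0 in auto)
    also have "\<dots> = (LINT t|lborel. (1 / (2 * pi)) *\<^sub>R (indicat_real {0..2*pi} t *\<^sub>R (Re (F (cis t)) *\<^sub>R k t)))"
      by (intro Bochner_Integration.integral_cong) auto
    also have "\<dots> = (1 / (2 * pi)) *\<^sub>R (LINT t:{0..2*pi}|lborel. Re (F (cis t)) *\<^sub>R k t)"
      unfolding set_lebesgue_integral_def by (rule Bochner_Integration.integral_scaleR_right)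
    also have "\<dots> = (1 / (2 * pi)) *\<^sub>R (2 * pi * I)"
      by (simp only: set_borel_integral_eq_integral(2)[OF si] integral_unique[OF I])
    also have "\<dots> = I" by (simp add: scaleR_conv_of_real)
    finally show ?thesis .
  qed
  have "((\<lambda>t. Re (F (cis t)) *\<^sub>R 1) has_integral (2 * pi * 1)) {0..2*pi}"
  proof -
    have "((\<lambda>t. F (cis t)) has_integral (2 * pi * F 0)) {0..2*pi}"
      using Cauchy_integral_unit_circle[OF F, of 0] by simp
    from has_integral_Re[OF this] show ?thesis by (simp add: F0)
  qed
  note mass = this
  have si: "set_integrable lborel {0..2*pi} (\<lambda>t. Re (F (cis t)))"
    unfolding set_integrable_def by (rule borel_integrable_compact[OF compact_Icc cF])
  have dint: "integrable lborel ?d"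
    using integrable_divide[OF si[unfolded set_integrable_def], of "2 * pi"] by simp
  have "(LINT t|lborel. ?d t) = (1 / (2 * pi)) * (LINT t:{0..2*pi}|lborel. Re (F (cis t)))"
    unfolding set_lebesgue_integral_def by simp
  also have "\<dots> = 1"
    using set_borel_integral_eq_integral(2)[OF si] integral_unique[OF mass] by simp
  finally have d1: "(\<integral>\<^sup>+ t. ennreal (?d t) \<partial>lborel) = 1"
    using d0 by (subst nn_integral_eq_integral[OF dint]) auto
  have em: "emeasure \<nu> A = 1" if "{0..2*pi} \<subseteq> A" "A \<in> sets borel" for A
  proof -
    have "emeasure \<nu> A = (\<integral>\<^sup>+ t. ennreal (?d t) * indicator A t \<partial>lborel)"
      unfolding \<nu>_def using that by (intro emeasure_density) auto
    also have "\<dots> = (\<integral>\<^sup>+ t. ennreal (?d t) \<partial>lborel)"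
      using that by (intro nn_integral_cong) (auto simp: indicator_def)
    finally show ?thesis by (simp only: d1)
  qed
  have "prob_space \<nu>"
    by (rule prob_spaceI) (use em[of UNIV] in \<open>simp add: \<nu>_def\<close>)
  then show "real_distribution \<nu>"
    by (simp add: real_distribution_def real_distribution_axioms_def \<nu>_def)
  have "2 * pi \<le> 7" using pi_less_4 pi_approx by simp
  then show "measure \<nu> {-1<..7} = 1"
    using em[of "{-1<..7}"] by (simp add: measure_def subset_iff)
  show "(LINT t|\<nu>. (cis t + w) / (cis t - w)) = F w" if w: "cmod w < 1"
  proof (rule integral_eq)
    show "continuous_on UNIV (\<lambda>t. (cis t + w) / (cis t - w))"
      by (rule continuous_on_schwarz_kernel[OF w])
    show "((\<lambda>t. Re (F (cis t)) *\<^sub>R ((cis t + w) / (cis t - w))) has_integral (2 * pi * F w)) {0..2*pi}"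
      using schwarz_integral_formula[OF F w] by (simp add: F0)
  qed
qed

text \<open>
  The dilated functions \<open>F(r u)\<close> with \<open>r < 1\<close> are holomorphic up to the boundary. Their densities have
  uniformly bounded supports, so they converge weakly along a subsequence as \<open>r\<close> tends to \<open>1\<close>, and the
  Schwarz kernel is a bounded continuous function.
\<close>

theorem herglotz_disc:
  fixes F :: "complex \<Rightarrow> complex"
  assumes F: "F holomorphic_on ball 0 1" and pos: "\<And>w. w \<in> ball 0 1 \<Longrightarrow> 0 \<le> Re (F w)" and F0: "F 0 = 1"
  shows "\<exists>M. real_distribution M \<and> (\<forall>w. cmod w < 1 \<longrightarrow> (LINT t|M. (cis t + w) / (cis t - w)) = F w)"
proof -
  define r where "r = (\<lambda>n. 1 - 1 / real (n + 2))"
  have r: "0 < r n" "r n < 1" for n by (simp_all add: r_def)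
  define \<nu> where "\<nu> n = density lborel (\<lambda>t. ennreal (indicator {0..2*pi} t * (Re (F (of_real (r n) * cis t)) / (2 * pi))))" for n
  have sub: "of_real (r n) * u \<in> ball 0 1" if "u \<in> cball 0 1" for n and u :: complex
  proof -
    have "r n * cmod u \<le> r n * 1" using that r[of n] by (intro mult_left_mono) auto
    also have "\<dots> < 1" using r[of n] by simp
    finally show ?thesis using r[of n] by (simp add: norm_mult)
  qed
  have hol: "(\<lambda>u. F (of_real (r n) * u)) holomorphic_on cball 0 1" for n
    by (rule holomorphic_on_compose_gen[OF _ F, unfolded o_def]) (use sub in \<open>auto intro!: holomorphic_intros simp del: mem_ball\<close>)
  have pos': "0 \<le> Re (F (of_real (r n) * u))" if "u \<in> cball 0 1" for n u
    by (rule pos[OF sub[OF that]])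
  have F0': "F (of_real (r n) * 0) = 1" for n by (simp add: F0)
  note \<nu> = circle_density[OF hol pos' F0', folded \<nu>_def]
  have "tight \<nu>"
    unfolding tight_def
  proof (intro conjI allI impI)
    fix e :: real assume "0 < e"
    then show "\<exists>a b. a < b \<and> (\<forall>n. 1 - e < measure (\<nu> n) {a<..b})"
      using \<nu>(2) by (intro exI[of _ "-1"] exI[of _ 7]) simp
  qed (rule \<nu>(1))
  from tight_imp_convergent_subsubsequence[OF this strict_mono_id]
  obtain s M where s: "strict_mono (s :: nat \<Rightarrow> nat)" and M: "real_distribution M"
    and conv: "weak_conv_m (\<lambda>n. \<nu> (s n)) M" by (auto simp: o_def)
  have "(LINT t|M. (cis t + w) / (cis t - w)) = F w" if w: "cmod w < 1" for w
  proof (rule LIMSEQ_unique)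
    show "(\<lambda>n. LINT t|\<nu> (s n). (cis t + w) / (cis t - w)) \<longlonglongrightarrow> (LINT t|M. (cis t + w) / (cis t - w))"
    proof (rule weak_conv_imp_integral_bdd_continuous_conv[OF _ M conv])
      show "real_distribution (\<nu> (s n))" for n by (rule \<nu>(1))
      show "isCont (\<lambda>t. (cis t + w) / (cis t - w)) t" for t
        using continuous_on_schwarz_kernel[OF w] by (simp add: continuous_on_eq_continuous_at)
    qed (rule cmod_schwarz_kernel_le[OF w])
    have "r \<longlonglongrightarrow> 1" unfolding r_def by real_asymp
    then have "(\<lambda>n. r (s n)) \<longlonglongrightarrow> 1" using LIMSEQ_subseq_LIMSEQ[OF _ s] by (auto simp: o_def)
    then have "(\<lambda>n. of_real (r (s n)) * w) \<longlonglongrightarrow> of_real 1 * w" by (intro tendsto_intros)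
    moreover have "isCont F w"
      using holomorphic_on_imp_continuous_on[OF F] w by (simp add: continuous_on_eq_continuous_at)
    ultimately have "(\<lambda>n. F (of_real (r (s n)) * w)) \<longlonglongrightarrow> F w"
      by (intro isCont_tendsto_compose[of w F]) simp_all
    then show "(\<lambda>n. LINT t|\<nu> (s n). (cis t + w) / (cis t - w)) \<longlonglongrightarrow> F w"
      using \<nu>(3)[OF _ w] by simp
  qed
  with M show ?thesis by blast
qed


text \<open>
  This is \<open>- cot (t/2)\<close>, the real number corresponding to \<open>cis t\<close> under the Cayley transform
  \<open>u \<mapsto> i (1 + u)/(1 - u)\<close>. At \<open>cis t = 1\<close>, which corresponds to infinity, its value is \<open>0\<close>.
\<close>

definition line_coord :: "real \<Rightarrow> real" where
  "line_coord t = - sin t / (1 - cos t)"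

lemma line_coord_measurable [measurable]: "line_coord \<in> borel_measurable borel"
  unfolding line_coord_def by measurable

lemma cis_line_coord:
  assumes "cos t \<noteq> 1"
  shows "(cis t - 1) * line_coord t = - \<i> * (cis t + 1)"
proof -
  have 0: "1 - cos t \<noteq> 0" using assms by simp
  have "(cos t)\<^sup>2 + (sin t)\<^sup>2 = 1" by simp
  then have "sin t * sin t = (1 - cos t) * (1 + cos t)" by (simp add: power2_eq_square algebra_simps)
  then show ?thesis using 0
    by (simp add: complex_eq_iff line_coord_def field_simps)
qed

lemma cayley_in_disc:
  assumes "Im z > 0"
  shows "cmod ((z - \<i>) / (z + \<i>)) < 1"
proof -
  have "(cmod (z - \<i>))\<^sup>2 < (cmod (z + \<i>))\<^sup>2"
    using assms by (simp add: cmod_power2) (simp add: power2_eq_square algebra_simps)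
  then have "cmod (z - \<i>) < cmod (z + \<i>)" by (rule power2_less_imp_less) simp
  then show ?thesis by (simp add: norm_divide divide_less_eq)
qed

text \<open>
  The Cayley transform turns the Schwarz kernel into \<open>(1 + t z)/(t - z)\<close>, which is \<open>1 + t\<^sup>2\<close> times the
  kernel of the Donoghue class. The point \<open>1\<close> of the circle contributes the linear function \<open>z\<close>.
\<close>

lemma schwarz_kernel_cayley:
  fixes z :: complex
  assumes z: "Im z > 0"
  defines "w \<equiv> (z - \<i>) / (z + \<i>)"
  shows "cos t = 1 \<Longrightarrow> \<i> * ((cis t + w) / (cis t - w)) = z"
    and "cos t \<noteq> 1 \<Longrightarrow> \<i> * ((cis t + w) / (cis t - w)) = (1 + of_real (line_coord t) * z) / (of_real (line_coord t) - z)"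
proof -
  have zi: "z + \<i> \<noteq> 0" using z by (auto simp: complex_eq_iff)
  have w: "cmod w < 1" unfolding w_def by (rule cayley_in_disc[OF z])
  have ne: "cis t - w \<noteq> 0" using w norm_cis[of t] by auto
  have num: "(cis t + w) * (z + \<i>) = z * (cis t + 1) + \<i> * (cis t - 1)"
    and den: "(cis t - w) * (z + \<i>) = z * (cis t - 1) + \<i> * (cis t + 1)"
    using zi by (simp_all add: w_def field_simps)
  have quot: "(cis t + w) / (cis t - w) = (z * (cis t + 1) + \<i> * (cis t - 1)) / (z * (cis t - 1) + \<i> * (cis t + 1))"
    unfolding num[symmetric] den[symmetric] using zi by simp
  have den0: "z * (cis t - 1) + \<i> * (cis t + 1) \<noteq> 0"
    unfolding den[symmetric] using zi ne by simp
  show "\<i> * ((cis t + w) / (cis t - w)) = z" if "cos t = 1"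
  proof -
    have "sin t = 0" using that sin_cos_squared_add[of t] by simp
    then have "cis t = 1" using that by (simp add: complex_eq_iff)
    then show ?thesis unfolding quot by simp
  qed
  assume c: "cos t \<noteq> 1"
  let ?T = "complex_of_real (line_coord t)"
  have T: "(cis t - 1) * ?T = - \<i> * (cis t + 1)" by (rule cis_line_coord[OF c])
  have Tz: "?T - z \<noteq> 0" using z by (auto simp: complex_eq_iff)
  have c1: "cis t - 1 \<noteq> 0" using c by (auto simp: complex_eq_iff)
  have p: "\<i> * (cis t + 1) = - ((cis t - 1) * ?T)" unfolding T by simp
  have "\<i> * (z * (cis t + 1) + \<i> * (cis t - 1)) = z * (\<i> * (cis t + 1)) - (cis t - 1)"
    by (simp add: algebra_simps)
  also have "\<dots> = - (cis t - 1) * (1 + ?T * z)"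
    unfolding p by (simp add: algebra_simps)
  finally have N: "\<i> * (z * (cis t + 1) + \<i> * (cis t - 1)) = - (cis t - 1) * (1 + ?T * z)" .
  have Dn: "z * (cis t - 1) + \<i> * (cis t + 1) = - (cis t - 1) * (?T - z)"
    unfolding p by (simp add: algebra_simps)
  have "\<i> * ((cis t + w) / (cis t - w)) = (\<i> * (z * (cis t + 1) + \<i> * (cis t - 1))) / (z * (cis t - 1) + \<i> * (cis t + 1))"
    unfolding quot by simp
  also have "\<dots> = (1 + ?T * z) / (?T - z)"
    unfolding N unfolding Dn using c1 by simp
  finally show "\<i> * ((cis t + w) / (cis t - w)) = (1 + ?T * z) / (?T - z)" .
qed

lemma Im_line_kernel:
  assumes "Im z > 0"
  shows "Im ((1 + of_real t * z) / (of_real t - z)) = Im z * (1 + t\<^sup>2) / (cmod (of_real t - z))\<^sup>2"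
proof -
  have "(1 + of_real t * z) / (of_real t - z) = (1 + of_real t * z) * cnj (of_real t - z) / of_real ((cmod (of_real t - z))\<^sup>2)"
    by (subst complex_div_cnj) simp
  then show ?thesis
    by (simp add: Im_divide_of_real power2_eq_square algebra_simps)
qed

text \<open>
  The Herglotz measure of the disc is carried to the line. A mass at the point \<open>1\<close> of the circle is
  a term linear in \<open>z\<close>, which the first growth condition excludes. For a measure of finite total mass
  \<open>T Im f(iT)\<close> would be bounded by that mass.
\<close>

theorem donoghue_classI:
  assumes f: "f holomorphic_on {z. Im z > 0}" and pos: "\<And>z. Im z > 0 \<Longrightarrow> Im (f z) > 0" and fi: "f \<i> = \<i>"
    and decay: "((\<lambda>T. Im (f (\<i> * of_real T)) / T) \<longlongrightarrow> 0) at_top"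
    and unbounded: "\<And>C. \<exists>T>0. C < T * Im (f (\<i> * of_real T))"
  shows "f \<in> donoghue_class"
proof -
  have op: "open {z. Im z > 0}" by (simp add: open_halfspace_Im_gt)
  define F where "F = (\<lambda>w. - \<i> * f (\<i> * ((1 + w) / (1 - w))))"
  have disc: "1 - w \<noteq> 0" "Im (\<i> * ((1 + w) / (1 - w))) > 0" if "w \<in> ball 0 1" for w
  proof -
    have w: "cmod w < 1" using that by simp
    then show 1: "1 - w \<noteq> 0" by auto
    have "Re w * Re w + Im w * Im w < 1"
      using power_strict_mono[OF w norm_ge_zero, of 2] by (simp add: cmod_power2) (simp add: power2_eq_square)
    moreover have "0 < (cmod (1 - w))\<^sup>2" using 1 by simp
    moreover have "Re ((1 + w) / (1 - w)) = (1 - (Re w * Re w + Im w * Im w)) / (cmod (1 - w))\<^sup>2"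
      by (simp add: Re_divide cmod_power2) (simp add: power2_eq_square algebra_simps)
    ultimately show "Im (\<i> * ((1 + w) / (1 - w))) > 0" by (simp only: Im_i_times zero_less_divide_iff) simp
  qed
  have Fhol: "F holomorphic_on ball 0 1"
    unfolding F_def
  proof (intro holomorphic_intros)
    show "(\<lambda>w. f (\<i> * ((1 + w) / (1 - w)))) holomorphic_on ball 0 1"
      by (rule holomorphic_on_compose_gen[OF _ f, unfolded o_def])
        (use disc in \<open>auto intro!: holomorphic_intros simp del: mem_ball\<close>)
  qed
  have Fpos: "0 \<le> Re (F w)" if "w \<in> ball 0 1" for w
    using pos[OF disc(2)[OF that]] by (simp add: F_def)
  have F0: "F 0 = 1" by (simp add: F_def fi)
  obtain M where M: "real_distribution M"
    and rep: "\<And>w. cmod w < 1 \<Longrightarrow> (LINT t|M. (cis t + w) / (cis t - w)) = F w"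
    using herglotz_disc[OF Fhol Fpos F0] by blast
  interpret real_distribution M by (rule M)
  let ?w = "\<lambda>z. (z - \<i>) / (z + \<i>)"
  let ?k = "\<lambda>z t. \<i> * ((cis t + ?w z) / (cis t - ?w z))"
  have w1: "cmod (?w z) < 1" if "Im z > 0" for z by (rule cayley_in_disc[OF that])
  have kint: "integrable M (?k z)" if z: "Im z > 0" for z
  proof (rule integrable_mult_right, rule integrable_const_bound)
    show "AE t in M. norm ((cis t + ?w z) / (cis t - ?w z)) \<le> 2 / (1 - cmod (?w z))"
      by (rule AE_I2) (rule cmod_schwarz_kernel_le[OF w1[OF z]])
    show "(\<lambda>t. (cis t + ?w z) / (cis t - ?w z)) \<in> borel_measurable M"
      using borel_measurable_continuous_onI[OF continuous_on_schwarz_kernel[OF w1[OF z]]] by simp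
  qed
  have frep: "f z = (LINT t|M. ?k z t)" if z: "Im z > 0" for z
  proof -
    have zi: "z + \<i> \<noteq> 0" using z by (auto simp: complex_eq_iff)
    have "\<i> * ((1 + ?w z) / (1 - ?w z)) = z"
      using schwarz_kernel_cayley(1)[OF z, of 0] by simp
    then have "f z = \<i> * F (?w z)" by (simp add: F_def)
    then show ?thesis by (simp only: rep[OF w1[OF z], symmetric] Bochner_Integration.integral_mult_right_zero)
  qed
  \<comment> \<open>The set \<open>A\<close> is the point at infinity; off it the kernel has nonnegative imaginary part.\<close>
  define A where "A = {t::real. cos t = 1}"
  have A [measurable]: "A \<in> sets borel" unfolding A_def by measurable
  have kpos: "0 \<le> Im (?k z t)" if z: "Im z > 0" for z t
  proof (cases "cos t = 1")
    case True
    show ?thesis unfolding schwarz_kernel_cayley(1)[OF z True] using z by simp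
  next
    case False
    show ?thesis unfolding schwarz_kernel_cayley(2)[OF z False] Im_line_kernel[OF z] using z by simp
  qed
  have Abound: "measure M A \<le> Im (f (\<i> * of_real T)) / T" if T: "T > 0" for T
  proof -
    have z: "Im (\<i> * complex_of_real T) > 0" using T by simp
    have "T * measure M A = (LINT t|M. T * indicator A t)" by simp
    also have "\<dots> \<le> (LINT t|M. Im (?k (\<i> * of_real T) t))"
    proof (rule integral_mono)
      show "integrable M (\<lambda>t. T * indicat_real A t)"
        by (intro integrable_mult_right integrable_const_bound[of _ 1]) (auto simp: indicator_def)
      show "integrable M (\<lambda>t. Im (?k (\<i> * of_real T) t))"
        by (rule integrable_Im[OF kint[OF z]])
      show "T * indicator A t \<le> Im (?k (\<i> * of_real T) t)" for t
        using kpos[OF z, of t] schwarz_kernel_cayley(1)[OF z, of t] by (cases "t \<in> A") (simp_all add: A_def)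
    qed
    also have "\<dots> = Im (f (\<i> * of_real T))"
      unfolding frep[OF z] by (rule integral_Im[OF kint[OF z]])
    finally show ?thesis using T by (simp add: field_simps)
  qed
  have "eventually (\<lambda>T. measure M A \<le> Im (f (\<i> * of_real T)) / T) at_top"
    by (rule eventually_mono[OF eventually_gt_at_top[of 0] Abound])
  from tendsto_lowerbound[OF decay this] have "measure M A = 0"
    using measure_nonneg[of M A] by simp
  then have "emeasure M A = 0" by (simp add: emeasure_eq_measure)
  then have "A \<in> null_sets M" by (simp add: null_sets_def)
  then have AEA: "AE t in M. cos t \<noteq> 1"
    using AE_not_in by (fastforce simp: A_def)
  define N where "N = distr M borel line_coord"
  have Nsets [measurable_cong]: "sets N = sets borel" by (simp add: N_def)
  have Tm [measurable]: "line_coord \<in> borel_measurable M" using line_coord_measurable by simp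
  have N: "prob_space N" unfolding N_def by (rule prob_space_distr) simp
  have km [measurable]: "(\<lambda>t::real. (1 + of_real t * z) / (of_real t - z)) \<in> borel_measurable borel" for z :: complex
    by measurable
  have kAE: "AE t in M. ?k z t = (1 + of_real (line_coord t) * z) / (of_real (line_coord t) - z)" if z: "Im z > 0" for z :: complex
    using AEA by eventually_elim (rule schwarz_kernel_cayley(2)[OF z])
  have Nint: "integrable N (\<lambda>t. (1 + of_real t * z) / (of_real t - z))" if z: "Im z > 0" for z
    unfolding N_def
    by (subst integrable_distr_eq) (auto intro!: integrable_cong_AE_imp[OF kint[OF z]] kAE[OF z])
  have fN: "f z = (LINT t|N. (1 + of_real t * z) / (of_real t - z))" if z: "Im z > 0" for z
  proof -
    have "(LINT t|N. (1 + of_real t * z) / (of_real t - z)) = (LINT t|M. (1 + of_real (line_coord t) * z) / (of_real (line_coord t) - z))"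
      unfolding N_def by (rule integral_distr) simp_all
    also have "\<dots> = (LINT t|M. ?k z t)"
      using kAE[OF z] borel_measurable_integrable[OF kint[OF z]]
      by (intro integral_cong_AE) (auto elim: eventually_mono)
    finally show ?thesis by (simp add: frep[OF z])
  qed
  define \<sigma> where "\<sigma> = density N (\<lambda>t. ennreal (1 + t\<^sup>2))"
  have one: "0 < 1 + t\<^sup>2" for t :: real by (simp add: add_pos_nonneg)
  have "(\<integral>\<^sup>+ t. ennreal (1 / (1 + t\<^sup>2)) \<partial>\<sigma>) = (\<integral>\<^sup>+ t. ennreal (1 + t\<^sup>2) * ennreal (1 / (1 + t\<^sup>2)) \<partial>N)"
    unfolding \<sigma>_def by (rule nn_integral_density) measurable
  also have "\<dots> = (\<integral>\<^sup>+ t. 1 \<partial>N)"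
  proof (rule nn_integral_cong)
    fix t :: real
    have "(1 + t\<^sup>2) * (1 / (1 + t\<^sup>2)) = 1" using one[of t] by simp
    then show "ennreal (1 + t\<^sup>2) * ennreal (1 / (1 + t\<^sup>2)) = 1"
      by (simp only: ennreal_mult'[OF one[THEN less_imp_le], symmetric] ennreal_1)
  qed
  also have "\<dots> = 1" using prob_space.emeasure_space_1[OF N] by simp
  finally have mass: "(\<integral>\<^sup>+ t. ennreal (1 / (1 + t\<^sup>2)) \<partial>\<sigma>) = 1" .
  have repr: "f z = (LINT t|\<sigma>. 1 / (of_real t - z) - of_real (t / (1 + t\<^sup>2)))" if z: "Im z > 0" for z
  proof -
    have "(LINT t|\<sigma>. 1 / (of_real t - z) - of_real (t / (1 + t\<^sup>2))) =
        (LINT t|N. (1 + t\<^sup>2) *\<^sub>R (1 / (of_real t - z) - of_real (t / (1 + t\<^sup>2))))"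
      unfolding \<sigma>_def by (rule integral_density) (auto simp: one[THEN less_imp_le])
    also have "\<dots> = (LINT t|N. (1 + of_real t * z) / (of_real t - z))"
    proof (rule Bochner_Integration.integral_cong[OF refl])
      fix t :: real
      have tz: "complex_of_real t - z \<noteq> 0" using z by (auto simp: complex_eq_iff)
      have o: "complex_of_real (1 + t\<^sup>2) \<noteq> 0" using one[of t] by (simp only: of_real_eq_0_iff)
      have "(1 + t\<^sup>2) *\<^sub>R (1 / (of_real t - z) - of_real (t / (1 + t\<^sup>2))) =
          of_real (1 + t\<^sup>2) / (of_real t - z) - complex_of_real t"
        using o unfolding scaleR_conv_of_real right_diff_distrib of_real_divide by simp
      also have "\<dots> = (1 + of_real t * z) / (of_real t - z)"
        using tz by (simp add: field_simps power2_eq_square)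
      finally show "(1 + t\<^sup>2) *\<^sub>R (1 / (of_real t - z) - of_real (t / (1 + t\<^sup>2))) = (1 + of_real t * z) / (of_real t - z)" .
    qed
    finally show ?thesis by (simp add: fN[OF z])
  qed
  have "emeasure \<sigma> UNIV = \<infinity>"
  proof (rule ccontr)
    assume fin: "emeasure \<sigma> UNIV \<noteq> \<infinity>"
    have "emeasure \<sigma> UNIV = (\<integral>\<^sup>+ t. ennreal (1 + t\<^sup>2) \<partial>N)"
      unfolding \<sigma>_def by (subst emeasure_density) (auto simp: N_def)
    with fin have int: "integrable N (\<lambda>t. 1 + t\<^sup>2)"
      by (intro integrableI_nonneg) (auto simp: less_top one[THEN less_imp_le])
    obtain T where T: "T > 0" "(LINT t|N. 1 + t\<^sup>2) < T * Im (f (\<i> * of_real T))" using unbounded by blast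
    have z: "Im (\<i> * complex_of_real T) > 0" using T by simp
    have "T * Im (f (\<i> * of_real T)) = (LINT t|N. T * Im ((1 + of_real t * (\<i> * of_real T)) / (of_real t - \<i> * of_real T)))"
      unfolding fN[OF z] integral_Im[OF Nint[OF z], symmetric] by simp
    also have "\<dots> \<le> (LINT t|N. 1 + t\<^sup>2)"
    proof (rule integral_mono[OF _ int])
      show "integrable N (\<lambda>t. T * Im ((1 + of_real t * (\<i> * of_real T)) / (of_real t - \<i> * of_real T)))"
        by (intro integrable_mult_right integrable_Im[OF Nint[OF z]])
      fix t :: real
      have "T * Im ((1 + of_real t * (\<i> * of_real T)) / (of_real t - \<i> * of_real T)) = (T\<^sup>2 / (t\<^sup>2 + T\<^sup>2)) * (1 + t\<^sup>2)"
        unfolding Im_line_kernel[OF z] by (simp add: cmod_power2) (simp add: power2_eq_square)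
      also have "\<dots> \<le> 1 * (1 + t\<^sup>2)"
        using T(1) by (intro mult_right_mono) (auto simp: divide_le_eq_1 add_nonneg_pos)
      finally show "T * Im ((1 + of_real t * (\<i> * of_real T)) / (of_real t - \<i> * of_real T)) \<le> 1 + t\<^sup>2" by simp
    qed
    finally show False using T(2) by simp
  qed
  moreover have "sets \<sigma> = sets borel" by (simp add: \<sigma>_def N_def)
  moreover have "f analytic_on {z. Im z > 0}" using f by (simp add: analytic_on_open[OF op])
  ultimately show ?thesis
    unfolding donoghue_class_def using pos mass repr by blast
qed

section \<open>Schroedinger L-systems\<close>

lemma donoghue_class_at_i:
  assumes "M \<in> donoghue_class"
  shows "M \<i> = \<i>"
proof -
  obtain \<sigma> :: "real measure" where sets [measurable_cong]: "sets \<sigma> = sets borel"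
    and mass: "(\<integral>\<^sup>+ t. ennreal (1 / (1 + t\<^sup>2)) \<partial>\<sigma>) = 1"
    and M: "\<And>z. Im z > 0 \<Longrightarrow> M z = (LINT t|\<sigma>. 1 / (of_real t - z) - of_real (t / (1 + t\<^sup>2)))"
    using assms by (auto simp: donoghue_class_def)
  have kernel: "1 / (of_real t - \<i>) - of_real (t / (1 + t\<^sup>2)) = \<i> * of_real (1 / (1 + t\<^sup>2))" for t :: real
    by (simp add: complex_eq_iff Re_divide Im_divide power2_eq_square add.commute)
  have "(LINT t|\<sigma>. 1 / (1 + t\<^sup>2)) = enn2real (\<integral>\<^sup>+ t. ennreal (1 / (1 + t\<^sup>2)) \<partial>\<sigma>)"
    by (rule integral_eq_nn_integral) (auto simp: add_nonneg_nonneg)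
  then have "(LINT t|\<sigma>. 1 / (1 + t\<^sup>2)) = 1" by (simp only: mass enn2real_1)
  moreover have "M \<i> = \<i> * of_real (LINT t|\<sigma>. 1 / (1 + t\<^sup>2))"
    using M[of \<i>] unfolding kernel Bochner_Integration.integral_mult_right_zero integral_complex_of_real by simp
  ultimately show ?thesis by simp
qed

text \<open>
  The parameter \<open>\<mu>\<close> is a point \<open>p/r\<close> of the real projective line, with \<open>1/0\<close> for infinity. In these
  coordinates the finite and the infinite case have the same formulas.
\<close>

lemma xreal_homogeneous_coordinates:
  assumes "Im h > 0"
  obtains p r :: real where "of_real p - of_real r * h \<noteq> 0"
    "\<And>y w. state_A l q \<mu> h y w = ip l (schr_expr l q y) w -
       (D1 l y l - h * y l) / (of_real p - of_real r * h) * (of_real p * cnj (w l) - of_real r * cnj (D1 l w l))"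
    "\<And>w. channel_g l \<mu> h w =
       of_real (sqrt (Im h) / cmod (of_real p - of_real r * h)) * (of_real p * cnj (w l) - of_real r * cnj (D1 l w l))"
proof (cases \<mu>)
  case (Fin x)
  show ?thesis
  proof (rule that[of x 1])
    show "of_real x - of_real 1 * h \<noteq> 0" using assms by (auto simp: complex_eq_iff)
  qed (simp_all add: Fin delta_def delta'_def)
next
  case Infty
  show ?thesis by (rule that[of 1 0]) (simp_all add: Infty delta_def delta'_def)
qed

text \<open>
  The Weyl solution is not zero in \<open>L\<^sub>2\<close>: otherwise Green's formula would annihilate its boundary values
  against every \<open>w\<close> in \<open>D*\<close>, although \<open>\<psi>(l) = -1\<close> and the boundary values of \<open>w\<close> are arbitrary.
\<close>

lemma weyl_solution:
  assumes sym: "min_symmetric l q" and m: "weyl_function l q m" and z: "Im z \<noteq> 0"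
  obtains \<psi> where "\<psi> \<in> D_star l q" "\<psi> l = - 1" "D1 l \<psi> l = m z"
    "\<And>w. w \<in> L2 l \<Longrightarrow> ip l (schr_expr l q \<psi>) w = z * ip l \<psi> w" "ip l \<psi> \<psi> \<noteq> 0"
proof -
  obtain \<phi>1 \<phi>2 where 1: "solves l q z \<phi>1" "\<phi>1 l = 0" "D1 l \<phi>1 l = 1"
    and 2: "solves l q z \<phi>2" "\<phi>2 l = - 1" "D1 l \<phi>2 l = 0"
    and L2: "(\<lambda>x. \<phi>2 x + m z * \<phi>1 x) \<in> L2 l"
    using m z unfolding weyl_function_def by blast
  define \<psi> where "\<psi> = (\<lambda>x. 1 * \<phi>2 x + m z * \<phi>1 x)"
  have s: "solves l q z \<psi>" unfolding \<psi>_def by (rule solves_lincomb[OF 2(1) 1(1)])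
  have \<psi>L2: "\<psi> \<in> L2 l" using L2 by (simp add: \<psi>_def)
  have ae: "AE x in lebesgue_on {l..}. z * \<psi> x + 0 * \<psi> x = schr_expr l q \<psi> x"
    using s by (auto simp: solves_def elim: eventually_mono)
  note zL2 = L2_lincomb[OF \<psi>L2 \<psi>L2, of z 0]
  have D: "\<psi> \<in> D_star l q"
    using s \<psi>L2 L2_cong_AE[OF zL2 ae] by (simp add: D_star_def solves_def)
  have l: "\<psi> l = - 1" "D1 l \<psi> l = m z"
    using 1 2 AC2_lincomb(2)[of \<phi>2 l \<phi>1 l 1 "m z"] by (auto simp: solves_def \<psi>_def)
  have eig: "ip l (schr_expr l q \<psi>) w = z * ip l \<psi> w" if "w \<in> L2 l" for w
  proof -
    have "ip l (schr_expr l q \<psi>) w = ip l (\<lambda>x. z * \<psi> x + 0 * \<psi> x) w"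
      by (rule ip_cong_AE[symmetric, OF zL2 that ae]) simp
    then show ?thesis by (simp only: ip_lincomb_left[OF \<psi>L2 \<psi>L2 that]) simp
  qed
  have "ip l \<psi> \<psi> \<noteq> 0"
  proof
    assume "ip l \<psi> \<psi> = 0"
    then have "(LINT x|lebesgue_on {l..}. (cmod (\<psi> x))\<^sup>2) = 0" by (simp add: ip_self)
    then have "AE x in lebesgue_on {l..}. (cmod (\<psi> x))\<^sup>2 = 0"
      by (subst (asm) integral_nonneg_eq_0_iff_AE) (use L2_D(2)[OF \<psi>L2] in auto)
    then have ae0: "AE x in lebesgue_on {l..}. \<psi> x = 0" by eventually_elim simp
    have null: "ip l \<psi> f = 0" if "f \<in> L2 l" for f
    proof -
      have "ip l \<psi> f = ip l (\<lambda>_. 0) f" by (rule ip_cong_AE[OF \<psi>L2 that ae0]) simp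
      then show ?thesis by (simp add: ip_def)
    qed
    obtain w where w: "w \<in> D_star l q" "w l = 0" "D1 l w l = 1"
      by (rule compactly_supported_boundary_values[OF m zero_less_one]) blast
    have "0 = D1 l \<psi> l * cnj (w l) - \<psi> l * cnj (D1 l w l)"
      using green_formula[OF sym m D w(1)] D_star_D[OF w(1)] by (simp add: eig null)
    then show False using l w by simp
  qed
  then show ?thesis using that D l eig by blast
qed

locale schroedinger_system =
  fixes l :: real and q :: "real \<Rightarrow> real" and h :: complex and \<mu> :: xreal
    and m :: "complex \<Rightarrow> complex" and p r :: real
  assumes symmetric: "min_symmetric l q" and weyl: "weyl_function l q m" and h: "Im h > 0"
    and nz: "of_real p - of_real r * h \<noteq> 0"
    and A: "\<And>y w. state_A l q \<mu> h y w = ip l (schr_expr l q y) w -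
       (D1 l y l - h * y l) / (of_real p - of_real r * h) * (of_real p * cnj (w l) - of_real r * cnj (D1 l w l))"
    and g: "\<And>w. channel_g l \<mu> h w =
       of_real (sqrt (Im h) / cmod (of_real p - of_real r * h)) * (of_real p * cnj (w l) - of_real r * cnj (D1 l w l))"
begin

abbreviation "\<Theta> \<equiv> schr_lsystem l q \<mu> h"
abbreviation "d \<equiv> of_real p - of_real r * h"
definition "\<kappa> = complex_of_real (sqrt (Im h) / cmod d)"

text \<open>
  The boundary functional whose kernel is the domain of the self-adjoint restriction of \<open>Re A\<close>.
\<close>

definition Q :: "(real \<Rightarrow> complex) \<Rightarrow> complex" where
  "Q y = ((D1 l y l - h * y l) / d + (D1 l y l - cnj h * y l) / cnj d) / 2"

lemma cnj_d_nz: "cnj d \<noteq> 0"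
  using nz by (simp only: complex_cnj_zero_iff not_False_eq_True)

lemma kappa_nz: "\<kappa> \<noteq> 0"
  using h nz by (simp add: \<kappa>_def)

lemma channel_op_eq: "channel_op \<Theta> 1 w = \<kappa> * (of_real p * cnj (w l) - of_real r * cnj (D1 l w l))"
  by (simp add: schr_lsystem_def g \<kappa>_def)

text \<open>
  Green's formula turns the adjoint of \<open>A\<close> into \<open>(L y, w)\<close> and boundary terms; together with those of
  \<open>A\<close> they are proportional to the channel functional of \<open>w\<close>.
\<close>

lemma state_re_eq:
  assumes y: "y \<in> D_star l q" and w: "w \<in> D_star l q"
  shows "state_re \<Theta> y w = ip l (schr_expr l q y) w - Q y * (of_real p * cnj (w l) - of_real r * cnj (D1 l w l))"
proof -
  let ?P = "complex_of_real p" and ?R = "complex_of_real r"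
  let ?X = "D1 l y l" and ?Y = "y l" and ?W = "cnj (w l)" and ?Z = "cnj (D1 l w l)"
  have cd: "?P - ?R * cnj h \<noteq> 0" using nz by (metis complex_cnj_complex_of_real complex_cnj_diff complex_cnj_mult complex_cnj_zero_iff)
  have "cnj (ip l (schr_expr l q w) y) = ip l y (schr_expr l q w)" by (rule ip_hermitian[symmetric])
  also have "\<dots> = ip l (schr_expr l q y) w - (?X * ?W - ?Y * ?Z)"
    using green_formula[OF symmetric weyl y w] by (simp add: algebra_simps)
  finally have adj: "cnj (ip l (schr_expr l q w) y) = ip l (schr_expr l q y) w - (?X * ?W - ?Y * ?Z)" .
  have key: "(?X * ?W - ?Y * ?Z) + (?Z - cnj h * ?W) / cnj d * (?P * ?Y - ?R * ?X) =
      (?X - cnj h * ?Y) / cnj d * (?P * ?W - ?R * ?Z)"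
    using cd by (simp add: field_simps)
  have half: "(i - a * B + (i - K - b)) / 2 = i - (a * B + (K + b)) / 2" for i a b B K :: complex
    by (simp add: field_simps)
  have "state_re \<Theta> y w = ip l (schr_expr l q y) w - ((?X - h * ?Y) / d * (?P * ?W - ?R * ?Z)
      + ((?X * ?W - ?Y * ?Z) + (?Z - cnj h * ?W) / cnj d * (?P * ?Y - ?R * ?X))) / 2"
    unfolding half[symmetric] by (simp add: state_re_def state_adj_def schr_lsystem_def A adj)
  also have "\<dots> = ip l (schr_expr l q y) w - Q y * (?P * ?W - ?R * ?Z)"
    unfolding key Q_def distrib_right[symmetric] by simp
  finally show ?thesis .
qed

lemma Q_lincomb:
  assumes "u \<in> D_star l q" "v \<in> D_star l q"
  shows "Q (\<lambda>x. a * u x + b * v x) = a * Q u + b * Q v"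
  by (simp add: Q_def AC2_lincomb(2)[OF D_star_D(1)[OF assms(1)] D_star_D(1)[OF assms(2)]] add_divide_distrib diff_divide_distrib algebra_simps)

lemma state_re_lincomb:
  assumes u: "u \<in> D_star l q" and v: "v \<in> D_star l q" and w: "w \<in> D_star l q"
  shows "state_re \<Theta> (\<lambda>x. a * u x + b * v x) w = a * state_re \<Theta> u w + b * state_re \<Theta> v w"
  unfolding state_re_eq[OF D_star_lincomb(1)[OF u v] w] state_re_eq[OF u w] state_re_eq[OF v w]
    Q_lincomb[OF u v] D_star_lincomb(2)[OF u v D_star_D(2)[OF w]]
  by (simp add: algebra_simps)

lemma state_re_hermitian: "state_re \<Theta> v u = cnj (state_re \<Theta> u v)"
  by (simp add: state_re_def state_adj_def)

text \<open>
  On the Weyl solution \<open>\<psi>\<close> the form \<open>Re A - z\<close> reduces to \<open>- Q \<psi>\<close> times the channel functional, up to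
  normalization. If \<open>Q \<psi>\<close> were zero, the nonreal \<open>z\<close> would be an eigenvalue of a Hermitian form.
\<close>

lemma resolvent_solution:
  assumes z: "Im z \<noteq> 0"
  obtains y where "y \<in> D_star l q"
    "\<And>w. w \<in> D_star l q \<Longrightarrow> state_re \<Theta> y w - z * ip l y w = channel_op \<Theta> 1 w"
    "cnj (channel_op \<Theta> 1 y) * ((m z + h) * cnj d + (m z + cnj h) * d) = 2 * Im h * (of_real p + of_real r * m z)"
proof -
  obtain \<psi> where \<psi>: "\<psi> \<in> D_star l q" "\<psi> l = - 1" "D1 l \<psi> l = m z"
    and eig: "\<And>w. w \<in> L2 l \<Longrightarrow> ip l (schr_expr l q \<psi>) w = z * ip l \<psi> w" and n: "ip l \<psi> \<psi> \<noteq> 0"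
    by (rule weyl_solution[OF symmetric weyl z]) blast
  have res: "state_re \<Theta> \<psi> w - z * ip l \<psi> w = - Q \<psi> * (of_real p * cnj (w l) - of_real r * cnj (D1 l w l))"
    if "w \<in> D_star l q" for w
    by (simp add: state_re_eq[OF \<psi>(1) that] eig[OF D_star_D(2)[OF that]])
  have Q: "Q \<psi> \<noteq> 0"
  proof
    assume "Q \<psi> = 0"
    then have "state_re \<Theta> \<psi> \<psi> = z * ip l \<psi> \<psi>" using res[OF \<psi>(1)] by simp
    moreover have "Im (state_re \<Theta> \<psi> \<psi>) = 0" using arg_cong[OF state_re_hermitian[of \<psi> \<psi>], of Im] by simp
    ultimately show False using z n by (simp add: ip_self)
  qed
  define y where "y = (\<lambda>x. (- \<kappa> / Q \<psi>) * \<psi> x + 0 * \<psi> x)"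
  have y: "y \<in> D_star l q" unfolding y_def by (rule D_star_lincomb(1)[OF \<psi>(1) \<psi>(1)])
  have "state_re \<Theta> y w - z * ip l y w = channel_op \<Theta> 1 w" if w: "w \<in> D_star l q" for w
  proof -
    have "state_re \<Theta> y w - z * ip l y w = (- \<kappa> / Q \<psi>) * (state_re \<Theta> \<psi> w - z * ip l \<psi> w)"
      unfolding y_def state_re_lincomb[OF \<psi>(1) \<psi>(1) w] ip_lincomb_left[OF D_star_D(2)[OF \<psi>(1)] D_star_D(2)[OF \<psi>(1)] D_star_D(2)[OF w]]
      by (simp add: algebra_simps)
    then show ?thesis unfolding res[OF w] channel_op_eq using Q by simp
  qed
  moreover have "cnj (channel_op \<Theta> 1 y) * ((m z + h) * cnj d + (m z + cnj h) * d) = 2 * Im h * (of_real p + of_real r * m z)"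
  proof -
    have "y l = \<kappa> / Q \<psi>" "D1 l y l = - \<kappa> / Q \<psi> * m z"
      using \<psi> AC2_lincomb(2)[OF D_star_D(1)[OF \<psi>(1)] D_star_D(1)[OF \<psi>(1)], of l "- \<kappa> / Q \<psi>" 0]
      by (simp_all add: y_def)
    moreover have "cnj \<kappa> = \<kappa>" by (simp add: \<kappa>_def)
    ultimately have V: "cnj (channel_op \<Theta> 1 y) = \<kappa> * \<kappa> * (of_real p + of_real r * m z) / Q \<psi>"
      unfolding channel_op_eq by (simp add: algebra_simps add_divide_distrib)
    have dd: "d * cnj d = of_real ((cmod d)\<^sup>2)" by (rule complex_norm_square[symmetric])
    have E: "(m z + h) * cnj d + (m z + cnj h) * d = 2 * (d * cnj d) * Q \<psi>"
      using nz cnj_d_nz \<psi> by (simp add: Q_def field_simps del: complex_cnj_diff complex_cnj_mult)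
    have K: "\<kappa> * \<kappa> * (d * cnj d) = Im h"
    proof -
      have "sqrt (Im h) / cmod d * (sqrt (Im h) / cmod d) * (cmod d)\<^sup>2 = Im h"
        using h nz by (simp add: power2_eq_square)
      then show ?thesis unfolding dd \<kappa>_def by (simp only: of_real_mult[symmetric])
    qed
    have "\<kappa> * \<kappa> * N / Q \<psi> * (2 * k * Q \<psi>) = 2 * (\<kappa> * \<kappa> * k) * N" for N k
      using Q by simp
    then show ?thesis unfolding V E by (simp only: K of_real_mult of_real_numeral)
  qed
  ultimately show ?thesis using that y by blast
qed

lemma re_resolvent_solves:
  assumes z: "Im z \<noteq> 0"
  defines "y \<equiv> re_resolvent \<Theta> z (channel_op \<Theta> 1)"
  shows "y \<in> D_star l q" "w \<in> D_star l q \<Longrightarrow> state_re \<Theta> y w - z * ip l y w = channel_op \<Theta> 1 w"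
proof -
  let ?P = "\<lambda>y. y \<in> hplus \<Theta> \<and> (\<forall>w\<in>hplus \<Theta>. state_re \<Theta> y w - z * embed \<Theta> y w = channel_op \<Theta> 1 w)"
  obtain y0 where "y0 \<in> D_star l q" "\<And>w. w \<in> D_star l q \<Longrightarrow> state_re \<Theta> y0 w - z * ip l y0 w = channel_op \<Theta> 1 w"
    by (rule resolvent_solution[OF z]) blast
  moreover have fields: "hplus \<Theta> = D_star l q" "embed \<Theta> = ip l" by (simp_all add: schr_lsystem_def)
  ultimately have "?P y0" by simp
  then have "?P y" unfolding y_def re_resolvent_def by (rule someI[where P = ?P])
  then show "y \<in> D_star l q" "w \<in> D_star l q \<Longrightarrow> state_re \<Theta> y w - z * ip l y w = channel_op \<Theta> 1 w"
    unfolding fields by blast+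
qed

sublocale hermitian_resolvent "L2 l" "D_star l q" "ip l" "state_re \<Theta>" "channel_op \<Theta> 1"
  "\<lambda>z. re_resolvent \<Theta> z (channel_op \<Theta> 1)"
proof
  show "ip l v u = cnj (ip l u v)" for u v by (rule ip_hermitian)
  show "0 \<le> Re (ip l u u)" for u by (simp add: ip_self)
  show "state_re \<Theta> v u = cnj (state_re \<Theta> u v)" for u v by (rule state_re_hermitian)
qed (simp_all add: D_star_D L2_lincomb D_star_lincomb ip_lincomb_left state_re_lincomb re_resolvent_solves)

lemma impedance_eq: "impedance \<Theta> = V"
  by (rule ext) (simp add: impedance_def channel_adj_def V_def)

lemma impedance_formula:
  assumes "Im z \<noteq> 0"
  shows "impedance \<Theta> z * ((m z + h) * cnj d + (m z + cnj h) * d) = 2 * Im h * (of_real p + of_real r * m z)"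
proof -
  obtain y where y: "y \<in> D_star l q"
    and sol: "\<And>w. w \<in> D_star l q \<Longrightarrow> state_re \<Theta> y w - z * ip l y w = channel_op \<Theta> 1 w"
    and eq: "cnj (channel_op \<Theta> 1 y) * ((m z + h) * cnj d + (m z + cnj h) * d) = 2 * Im h * (of_real p + of_real r * m z)"
    by (rule resolvent_solution[OF assms]) blast
  have "V z = cnj (channel_op \<Theta> 1 y)" by (rule V_eq_solution[OF assms y sol])
  with eq show ?thesis by (simp only: impedance_eq)
qed

text \<open>
  The equation \<open>V(i) = i\<close> in \<open>impedance_formula\<close> is linear in \<open>m(i)\<close>; the difference of its two sides
  has the factors \<open>m(i) + h\<close> and \<open>cnj d\<close>, of which the latter is not zero.
\<close>

lemma impedance_at_i_iff: "impedance \<Theta> \<i> = \<i> \<longleftrightarrow> h = - m \<i>"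
proof -
  let ?V = "impedance \<Theta> \<i>" and ?m = "m \<i>"
  let ?E = "(?m + h) * cnj d + (?m + cnj h) * d" and ?N = "2 * Im h * (of_real p + of_real r * ?m)"
  have VE: "?V * ?E = ?N" by (rule impedance_formula) simp
  have "complex_of_real (2 * Im h) = - \<i> * (h - cnj h)" by (simp add: complex_eq_iff)
  then have "?N = - \<i> * (h - cnj h) * (of_real p + of_real r * ?m)" by (simp only:)
  then have diff: "\<i> * ?E - ?N = 2 * \<i> * (?m + h) * cnj d"
    by (simp add: algebra_simps)
  show ?thesis
  proof
    assume "?V = \<i>"
    then have "\<i> * ?E - ?N = 0" using VE by simp
    then have "?m + h = 0" using cnj_d_nz unfolding diff by simp
    then show "h = - ?m" by (simp add: eq_neg_iff_add_eq_0 add.commute)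
  next
    assume hm: "h = - ?m"
    then have 0: "?m + h = 0" by simp
    have "\<i> * ?E - ?N = 2 * \<i> * (?m + h) * cnj d" by (rule diff)
    also have "\<dots> = 0" by (simp only: 0 mult_zero_left mult_zero_right)
    finally have "\<i> * ?E - ?N = 0" .
    then have "\<i> * ?E = ?N" by (simp only: right_minus_eq)
    then have "?V * ?E = \<i> * ?E" using VE by simp
    moreover have "?E \<noteq> 0"
    proof -
      have "?m + cnj h \<noteq> 0" using hm h by (auto simp: complex_eq_iff)
      then show ?thesis unfolding 0 using nz by simp
    qed
    ultimately show "?V = \<i>" by simp
  qed
qed

lemma boundary_annihilator:
  assumes w: "w \<in> D_star l q" and Q: "Q w = 0" and v: "v \<in> D_star l q"
  shows "state_re \<Theta> w v = ip l (schr_expr l q w) v"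
  by (simp add: state_re_eq[OF w v] Q)

text \<open>
  Elements of the domain of the self-adjoint restriction with a fixed nonzero channel value and
  arbitrarily small norm. The boundary values solve \<open>Q w = 0\<close>.
\<close>

lemma concentrated_test_function:
  assumes "0 < \<epsilon>"
  shows "\<exists>w f. w \<in> D_star l q \<and> f \<in> L2 l \<and> Re (ip l w w) < \<epsilon> \<and>
    channel_op \<Theta> 1 w = \<kappa> * (d * cnj d) \<and> (\<forall>v\<in>D_star l q. state_re \<Theta> w v = ip l f v)"
proof -
  let ?P = "complex_of_real p" and ?R = "complex_of_real r"
  let ?\<alpha> = "?P - ?R * of_real (Re h)" and ?\<beta> = "?P * of_real (Re h) - ?R * (h * cnj h)"
  obtain w where w: "w \<in> D_star l q" "w l = ?\<alpha>" "D1 l w l = ?\<beta>" "Re (ip l w w) < \<epsilon>"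
    by (rule compactly_supported_boundary_values[OF weyl assms]) blast
  have re: "complex_of_real (Re h) = (h + cnj h) / 2" by (simp add: complex_eq_iff)
  have 1: "?\<beta> - h * ?\<alpha> = - ((h - cnj h) / 2) * d"
    unfolding re by (simp add: field_simps)
  have 2: "?\<beta> - cnj h * ?\<alpha> = ((h - cnj h) / 2) * cnj d"
    unfolding re by (simp add: field_simps)
  have "(- k * a / a + k * b / b) / 2 = 0" if "a \<noteq> 0" "b \<noteq> 0" for a b k :: complex
    using that by simp
  from this[OF nz cnj_d_nz] have Q: "Q w = 0" unfolding Q_def w 1 2 .
  have "?P * cnj ?\<alpha> - ?R * cnj ?\<beta> = d * cnj d"
    by (simp add: complex_eq_iff algebra_simps)
  then have "channel_op \<Theta> 1 w = \<kappa> * (d * cnj d)" unfolding channel_op_eq w by simp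
  then show ?thesis using w(1,4) boundary_annihilator[OF w(1) Q] D_star_D(3)[OF w(1)] by blast
qed

text \<open>
  A small \<open>c\<close> with the boundary values of \<open>y\<close> puts \<open>y - c\<close> into the domain of the minimal operator; so
  this domain is dense in \<open>D*\<close> in the norm of \<open>L\<^sub>2\<close>.
\<close>

lemma boundary_correction:
  assumes y: "y \<in> D_star l q" and "0 < \<epsilon>"
  shows "\<exists>c f. c \<in> D_star l q \<and> f \<in> L2 l \<and> Re (ip l c c) < \<epsilon> \<and>
    (\<forall>v\<in>D_star l q. state_re \<Theta> (\<lambda>x. 1 * y x + (-1) * c x) v = ip l f v)"
proof -
  obtain c where c: "c \<in> D_star l q" "c l = y l" "D1 l c l = D1 l y l" "Re (ip l c c) < \<epsilon>"
    by (rule compactly_supported_boundary_values[OF weyl assms(2)]) blast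
  let ?w = "\<lambda>x. 1 * y x + (-1) * c x"
  have w: "?w \<in> D_star l q" by (rule D_star_lincomb(1)[OF y c(1)])
  have "Q c = Q y" by (simp add: Q_def c)
  then have "Q ?w = 0" unfolding Q_lincomb[OF y c(1)] by simp
  then show ?thesis using c(1,4) boundary_annihilator[OF w] D_star_D(3)[OF w] by blast
qed

theorem impedance_in_donoghue_class:
  assumes i: "impedance \<Theta> \<i> = \<i>"
  shows "impedance \<Theta> \<in> donoghue_class"
  unfolding impedance_eq
proof (rule donoghue_classI)
  have \<gamma>: "\<kappa> * (d * cnj d) \<noteq> 0" using kappa_nz nz cnj_d_nz by (simp only: mult_eq_0_iff not_False_eq_True simp_thms)
  show "V holomorphic_on {z. Im z > 0}" using V_analytic by (rule analytic_imp_holomorphic)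
  show "Im (V z) > 0" if "Im z > 0" for z
  proof -
    obtain w f where "w \<in> D_star l q" "f \<in> L2 l" "channel_op \<Theta> 1 w = \<kappa> * (d * cnj d)"
      "\<And>v. v \<in> D_star l q \<Longrightarrow> state_re \<Theta> w v = ip l f v"
      using concentrated_test_function[OF zero_less_one] by blast
    with \<gamma> show ?thesis using Im_V_pos[OF that, of w f] by metis
  qed
  show "V \<i> = \<i>" using i by (simp only: impedance_eq)
  show "((\<lambda>T. Im (V (\<i> * of_real T)) / T) \<longlongrightarrow> 0) at_top"
    by (rule Im_V_decay) (rule boundary_correction[OF Y_in_D], simp)
  show "\<exists>T>0. C < T * Im (V (\<i> * of_real T))" for C
    by (rule Im_V_unbounded[OF \<gamma>]) (rule concentrated_test_function)
qed

end

theorem theorem8: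
  fixes l :: real and q :: "real \<Rightarrow> real" and h :: complex and \<mu> :: xreal
    and m_inf :: "complex \<Rightarrow> complex"
  assumes "loc_summable l q"
    and "min_symmetric l q"
    and "deficiency_indices_1_1 l q"
    and "weyl_function l q m_inf"
    and "Im h > 0"
  shows "impedance (schr_lsystem l q \<mu> h) \<in> donoghue_class \<longleftrightarrow> h = - m_inf \<i>"
proof -
  obtain p r where nz: "of_real p - of_real r * h \<noteq> 0"
    and A: "\<And>y w. state_A l q \<mu> h y w = ip l (schr_expr l q y) w -
       (D1 l y l - h * y l) / (of_real p - of_real r * h) * (of_real p * cnj (w l) - of_real r * cnj (D1 l w l))"
    and g: "\<And>w. channel_g l \<mu> h w =
       of_real (sqrt (Im h) / cmod (of_real p - of_real r * h)) * (of_real p * cnj (w l) - of_real r * cnj (D1 l w l))"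
    by (rule xreal_homogeneous_coordinates[OF assms(5)]) blast
  interpret schroedinger_system l q h \<mu> m_inf p r
    by (rule schroedinger_system.intro) (fact assms nz A g)+
  show ?thesis
    using impedance_in_donoghue_class donoghue_class_at_i impedance_at_i_iff by blast
qed

end
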